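(* Let $a,b,p,q\in\mathbb{C}^n$ be non-zero and let $P,Q:\mathbf{U}(n)\to\mathbb{C}$ be given by $$P(z)=\sum_{j,\alpha}p_ja_\alpha z_{j\alpha},\qquad Q(z)=\sum_{k,\beta}q_kb_\beta z_{k\beta},$$ and assume that $PQ+\kappa(P,Q)$ does not vanish identically on $\mathbf{U}(n)$. Let $f$ be the restriction of $P/Q$ to $\{z\in\mathbf{SU}(n)\mid Q(z)\ne 0\}$. Then for each positive integer $d$ there exist $c_0,\dots,c_d\in\mathbb{C}$ such that $$\Phi_d(f,\tau(f))=\sum_{k=0}^d c_k\,f^{d-k}\,\tau(f)^k$$ is a proper biharmonic function defined on an open and dense subset of $\mathbf{SU}(n)$.
   Context: $\mathbf{U}(n)$ and $\mathbf{SU}(n)$ carry the Riemannian metrics induced from the left-invariant metric on $\mathbf{GL}_n(\mathbb{C})$ given on $\mathbb{C}^{n\times n}$ by $g(Z,W)=\mathrm{Re}\,\mathrm{trace}(ZW^* )$; $z_{j\alpha}$ ($1\le j,\alpha\le n$) are the matrix entries of $z\in\mathbf{U}(n)$. For complex-valued functions $f,h$ on an open subset of a Riemannian manifold, $\tau(f)=\mathrm{div}(\nabla f)$ is the Laplace-Beltrami operator (extended complex-linearly) and $\kappa(f,h)=g(\nabla f,\nabla h)$, where $g$ is extended complex-bilinearly. A function $F$ is proper biharmonic if $\tau(\tau(F))=0$ and $\tau(F)$ does not vanish identically. *)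

theory Defs
  imports "HOL-Analysis.Analysis"
begin

text \<open>
  A Riemannian metric on an open subset of a Euclidean space \<open>'a\<close> is a function
  \<open>g :: 'a \<Rightarrow> 'a \<Rightarrow> 'a \<Rightarrow> real\<close>, where \<open>g z v w\<close> is the inner product of the tangent
  vectors \<open>v\<close>, \<open>w\<close> at the point \<open>z\<close>. Below, \<open>W\<close> is an embedded submanifold of that open set
  (for instance a relatively open subset of a submanifold) with the metric induced from \<open>g\<close>.
  The tangent spaces of \<open>W\<close> are regarded as linear subspaces of \<open>'a\<close>, and vector fields on \<open>W\<close>
  as \<open>'a\<close>-valued functions.
\<close>

text \<open>
  Velocities of curves in \<open>W\<close>. For an embedded submanifold, differentiability of the curve at
  \<open>0\<close> is enough: it gives the same vectors as smooth curves do.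
\<close>

definition tangent_space :: "'a::euclidean_space set \<Rightarrow> 'a \<Rightarrow> 'a set" where
  "tangent_space W z =
     {v. \<exists>\<gamma>. (\<forall>t::real. \<gamma> t \<in> W) \<and> \<gamma> 0 = z \<and> (\<gamma> has_vector_derivative v) (at 0)}"

text \<open>
  For a function \<open>f\<close> differentiable along \<open>W\<close>, a linear map that is a derivative of \<open>f\<close> within
  \<open>W\<close> at \<open>z\<close> is determined only on \<open>tangent_space W z\<close>. There it is the differential of \<open>f\<close>, by
  the chain rule. In the sequel \<open>frechet_derivative f (at z within W)\<close> is applied to tangent
  vectors only.
\<close>

definition riem_grad ::
    "('a::euclidean_space \<Rightarrow> 'a \<Rightarrow> 'a \<Rightarrow> real) \<Rightarrow> 'a set \<Rightarrow> ('a \<Rightarrow> real) \<Rightarrow> 'a \<Rightarrow> 'a" where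
  "riem_grad g W u z =
     (THE X. X \<in> tangent_space W z \<and>
        (\<forall>v \<in> tangent_space W z. g z X v = frechet_derivative u (at z within W) v))"

text \<open>
  Christoffel symbols of the metric \<open>g\<close> on the ambient open set, in its linear coordinates:
  the Levi-Civita connection of \<open>g\<close> there is \<open>\<nabla>\<^sub>v X = D\<^sub>v X + christoffel g z v X\<close>.
\<close>

definition christoffel ::
    "('a::euclidean_space \<Rightarrow> 'a \<Rightarrow> 'a \<Rightarrow> real) \<Rightarrow> 'a \<Rightarrow> 'a \<Rightarrow> 'a \<Rightarrow> 'a" where
  "christoffel g z v w =
     (THE u. \<forall>x. 2 * g z u x =
          frechet_derivative (\<lambda>y. g y w x) (at z) v
        + frechet_derivative (\<lambda>y. g y v x) (at z) w
        - frechet_derivative (\<lambda>y. g y v w) (at z) x)"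

definition tangent_proj ::
    "('a::euclidean_space \<Rightarrow> 'a \<Rightarrow> 'a \<Rightarrow> real) \<Rightarrow> 'a set \<Rightarrow> 'a \<Rightarrow> 'a \<Rightarrow> 'a" where
  "tangent_proj g W z x =
     (THE t. t \<in> tangent_space W z \<and> (\<forall>v \<in> tangent_space W z. g z t v = g z x v))"

text \<open>
  The covariant derivative \<open>\<nabla>\<^sub>v X\<close> at \<open>z\<close>, for \<open>X\<close> a tangent vector field on \<open>W\<close> and \<open>v\<close> tangent
  to \<open>W\<close> at \<open>z\<close>: the Levi-Civita connection of an induced metric is the tangential part of the
  ambient one.
\<close>

definition levi_civita ::
    "('a::euclidean_space \<Rightarrow> 'a \<Rightarrow> 'a \<Rightarrow> real) \<Rightarrow> 'a set \<Rightarrow> ('a \<Rightarrow> 'a) \<Rightarrow> 'a \<Rightarrow> 'a \<Rightarrow> 'a" where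
  "levi_civita g W X z v =
     tangent_proj g W z
       (frechet_derivative X (at z within W) v + christoffel g z v (X z))"

definition orthonormal_basis_of ::
    "('a::euclidean_space \<Rightarrow> 'a \<Rightarrow> real) \<Rightarrow> 'a set \<Rightarrow> 'a set \<Rightarrow> bool" where
  "orthonormal_basis_of h T B \<longleftrightarrow>
     B \<subseteq> T \<and> span B = T \<and> (\<forall>e\<in>B. \<forall>e'\<in>B. h e e' = (if e = e' then 1 else 0))"

text \<open>
  The divergence of \<open>X\<close> is the trace of the endomorphism \<open>v \<mapsto> \<nabla>\<^sub>v X\<close> of the tangent space,
  evaluated in an orthonormal basis; the choice of the basis does not matter.
\<close>

definition riem_div ::
    "('a::euclidean_space \<Rightarrow> 'a \<Rightarrow> 'a \<Rightarrow> real) \<Rightarrow> 'a set \<Rightarrow> ('a \<Rightarrow> 'a) \<Rightarrow> 'a \<Rightarrow> real" where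
  "riem_div g W X z =
     (\<Sum>e \<in> (SOME B. orthonormal_basis_of (g z) (tangent_space W z) B).
        g z (levi_civita g W X z e) e)"

definition tau ::
    "('a::euclidean_space \<Rightarrow> 'a \<Rightarrow> 'a \<Rightarrow> real) \<Rightarrow> 'a set \<Rightarrow> ('a \<Rightarrow> complex) \<Rightarrow> 'a \<Rightarrow> complex" where
  "tau g W f z =
     Complex (riem_div g W (riem_grad g W (\<lambda>y. Re (f y))) z)
             (riem_div g W (riem_grad g W (\<lambda>y. Im (f y))) z)"

text \<open>
  The complex-bilinear extension of \<open>g\<close> applied to \<open>\<nabla>f = \<nabla>Re f + i \<nabla>Im f\<close> and \<open>\<nabla>h\<close>. The
  real and imaginary parts are kept apart because \<open>'a\<close> may carry a complex structure of its own
  that has nothing to do with the complexified tangent bundle.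
\<close>

definition kappa ::
    "('a::euclidean_space \<Rightarrow> 'a \<Rightarrow> 'a \<Rightarrow> real) \<Rightarrow> 'a set
       \<Rightarrow> ('a \<Rightarrow> complex) \<Rightarrow> ('a \<Rightarrow> complex) \<Rightarrow> 'a \<Rightarrow> complex" where
  "kappa g W f h z =
    (let f1 = riem_grad g W (\<lambda>y. Re (f y)) z; f2 = riem_grad g W (\<lambda>y. Im (f y)) z;
         h1 = riem_grad g W (\<lambda>y. Re (h y)) z; h2 = riem_grad g W (\<lambda>y. Im (h y)) z
     in Complex (g z f1 h1 - g z f2 h2) (g z f1 h2 + g z f2 h1))"

text \<open>Continuous differentiability of order \<open>k\<close> on an open subset \<open>S\<close> of a Euclidean space.\<close>

primrec Ck_on ::
    "nat \<Rightarrow> 'a::euclidean_space set \<Rightarrow> ('a \<Rightarrow> 'b::real_normed_vector) \<Rightarrow> bool" where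
  "Ck_on 0 S f \<longleftrightarrow> continuous_on S f"
| "Ck_on (Suc k) S f \<longleftrightarrow>
     (\<forall>x\<in>S. f differentiable (at x)) \<and>
     (\<forall>v. Ck_on k S (\<lambda>x. frechet_derivative f (at x) v))"

text \<open>
  Smooth functions on a submanifold are those that locally extend to smooth functions on open
  subsets of the ambient space.
\<close>

definition smooth_on_submanifold ::
    "'a::euclidean_space set \<Rightarrow> ('a \<Rightarrow> 'b::real_normed_vector) \<Rightarrow> bool" where
  "smooth_on_submanifold W f \<longleftrightarrow>
     (\<forall>z\<in>W. \<exists>U h. open U \<and> z \<in> U \<and> (\<forall>k. Ck_on k U h) \<and> (\<forall>x \<in> U \<inter> W. h x = f x))"

text \<open>
  Smoothness is part of the definition, because the total functions above return arbitrary
  values where derivatives do not exist.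
\<close>

definition proper_biharmonic_on ::
    "('a::euclidean_space \<Rightarrow> 'a \<Rightarrow> 'a \<Rightarrow> real) \<Rightarrow> 'a set \<Rightarrow> ('a \<Rightarrow> complex) \<Rightarrow> bool" where
  "proper_biharmonic_on g W F \<longleftrightarrow>
     smooth_on_submanifold W F \<and>
     (\<forall>z\<in>W. tau g W (tau g W F) z = 0) \<and>
     (\<exists>z\<in>W. tau g W F z \<noteq> 0)"

definition conj_transpose :: "complex^'n^'m \<Rightarrow> complex^'m^'n" where
  "conj_transpose A = map_matrix cnj (transpose A)"

text \<open>
  The left-invariant metric on the open set of invertible matrices that is given by
  \<open>Re (trace (Z W\<^sup>*))\<close> at the identity; the values at singular \<open>z\<close> are irrelevant.
\<close>

definition GL_metric :: "complex^'n^'n \<Rightarrow> complex^'n^'n \<Rightarrow> complex^'n^'n \<Rightarrow> real" where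
  "GL_metric z Z W =
     Re (trace ((matrix_inv z ** Z) ** conj_transpose (matrix_inv z ** W)))"

definition unitary_group :: "(complex^'n^'n) set" where
  "unitary_group = {z. z ** conj_transpose z = mat 1 \<and> conj_transpose z ** z = mat 1}"

definition special_unitary_group :: "(complex^'n^'n) set" where
  "special_unitary_group = {z \<in> unitary_group. det z = 1}"

end

theory Submission
  imports Defs
begin

text \<open>
  On the unitary groups the metric is the Euclidean one, and with an orthonormal basis of the Lie
  algebra one has \<open>\<tau>(F) = \<Sum>\<^sub>A A(A(F))\<close> and \<open>\<kappa>(F, G) = \<Sum>\<^sub>A A(F) A(G)\<close> for the left-invariant vector
  fields \<open>A\<close>. Completeness of the basis in the complexified Lie algebra evaluates both operators on
  matrix coefficients, and for \<open>f = P/Q\<close> and \<open>t = \<tau>(f)\<close> it yields \<open>\<tau>(t) = 0\<close>, \<open>\<kappa>(f, f) = f t\<close>,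
  \<open>\<kappa>(f, t) = t\<^sup>2\<close>, \<open>\<kappa>(t, t) = -2 t\<^sup>2\<close>. Hence \<open>e\<^sub>k = f\<^bsup>d-k\<^esup> t\<^sup>k\<close> satisfies
  \<open>\<tau>(e\<^sub>k) = (d\<^sup>2 - k\<^sup>2) e\<^bsub>k+1\<^esub> - 2 k (k - 1) e\<^sub>k\<close>. This triangular system has a harmonic solution with
  \<open>e\<^sub>1\<close>-coefficient \<open>d\<^sup>2\<close>, which is \<open>\<tau>\<close> of a combination starting with \<open>e\<^sub>0\<close>. It does not vanish
  identically because \<open>f/t\<close> satisfies no polynomial equation.
\<close>

section \<open>Smooth functions on open sets\<close>

text \<open>The operators of the definitions are built from definite descriptions, choices and
  derivatives within \<open>W\<close>, which are meaningful only on tangent vectors. So functions on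
  the group are replaced by extensions that are smooth on an open set of matrices, and there
  \<open>tau\<close> and \<open>kappa\<close> become sums of Lie derivatives.

  The hypothesis speaks of U(n), the conclusion of SU(n). Let R and S arise from P and Q by
  exchanging a and b. On U(n) one has \<open>kappa\<close>(P, Q) = -RS, so the hypothesis says that
  PQ - RS is not identically zero. This polynomial is homogeneous of degree 2. Hence a scalar
  carries a point where it is nonzero into SU(n), and t = -2 (PQ - RS)/Q^2 wherever Q is nonzero.

  Density of \<open>W\<close> and the absence of polynomial equations for f/t are obtained without
  real analyticity, by differentiating relations that hold on a relatively open part of SU(n). The
  Casimir sum refutes vanishing first derivatives of Q, and a polynomial relation is inherited by
  the derivative of the polynomial until a constant is left.\<close>

lemma frechet_derivative_cong_open:
  assumes "open S" "x \<in> S" "\<And>y. y \<in> S \<Longrightarrow> f y = g y"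
  shows "frechet_derivative f (at x) = frechet_derivative g (at x)"
proof -
  have "(f has_derivative D) (at x) \<longleftrightarrow> (g has_derivative D) (at x)" for D
    using assms has_derivative_transform_within_open[of f D x UNIV S g]
      has_derivative_transform_within_open[of g D x UNIV S f] by auto
  then show ?thesis
    by (simp add: frechet_derivative_def)
qed

lemma Ck_on_SucD:
  assumes "Ck_on (Suc k) S f"
  shows "x \<in> S \<Longrightarrow> (f has_derivative frechet_derivative f (at x)) (at x)"
    and "Ck_on k S (\<lambda>x. frechet_derivative f (at x) v)"
  using assms frechet_derivative_works by auto

lemma Ck_on_cong:
  assumes "open S" "Ck_on k S f" "\<And>x. x \<in> S \<Longrightarrow> f x = g x"
  shows "Ck_on k S g"
  using assms(2,3)
proof (induction k arbitrary: f g)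
  case 0
  then show ?case using continuous_on_cong[of S S f g] by auto
next
  case (Suc k)
  have "g differentiable (at x)" if "x \<in> S" for x
    using has_derivative_transform_within_open[OF Ck_on_SucD(1)[OF Suc.prems(1) that] assms(1) that]
      Suc.prems(2) by (auto simp: differentiable_def)
  moreover have "Ck_on k S (\<lambda>x. frechet_derivative g (at x) v)" for v
    by (rule Suc.IH[OF Ck_on_SucD(2)[OF Suc.prems(1)]])
      (simp add: frechet_derivative_cong_open[OF assms(1) _ Suc.prems(2)])
  ultimately show ?case by simp
qed

text \<open>\<open>Ck_on\<close> is phrased with the chosen \<open>frechet_derivative\<close>; this
  rule lets each closure proof supply an explicit formula instead.\<close>

lemma Ck_on_SucI:
  assumes "open S" "\<And>x. x \<in> S \<Longrightarrow> (f has_derivative f' x) (at x)"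
    and "\<And>v. Ck_on k S (\<lambda>x. f' x v)"
  shows "Ck_on (Suc k) S f"
proof -
  have "Ck_on k S (\<lambda>x. frechet_derivative f (at x) v)" for v
    using assms(2) frechet_derivative_at
    by (intro Ck_on_cong[OF assms(1) assms(3)[of v]]) fastforce
  then show ?thesis
    using assms(2) by (auto simp: differentiable_def)
qed

lemma Ck_on_lower: "Ck_on (Suc k) S f \<Longrightarrow> Ck_on k S f"
proof (induction k arbitrary: f)
  case 0
  then show ?case
    by (auto intro!: continuous_at_imp_continuous_on differentiable_imp_continuous_within)
next
  case (Suc k)
  then show ?case by auto
qed

lemma Ck_on_subset: "Ck_on k S f \<Longrightarrow> T \<subseteq> S \<Longrightarrow> Ck_on k T f"
  by (induction k arbitrary: f) (auto intro: continuous_on_subset)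

lemma Ck_on_const: "open S \<Longrightarrow> Ck_on k S (\<lambda>x. c)"
proof (induction k arbitrary: c)
  case (Suc k)
  then show ?case
    by (intro Ck_on_SucI[where f' = "\<lambda>x v. 0"] has_derivative_const)
qed auto

lemma Ck_on_bounded_linear:
  assumes "open S" "bounded_linear f"
  shows "Ck_on k S f"
proof (cases k)
  case 0
  then show ?thesis using assms(2) linear_continuous_on by auto
next
  case (Suc k')
  then show ?thesis
    using Ck_on_SucI[where f' = "\<lambda>x. f", OF assms(1) bounded_linear_imp_has_derivative[OF assms(2)]
        Ck_on_const[OF assms(1)]] by simp
qed

lemma Ck_on_compose_linear:
  assumes "open S" "bounded_linear h" "Ck_on k S f"
  shows "Ck_on k S (\<lambda>x. h (f x))"
  using assms(3)
proof (induction k arbitrary: f)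
  case 0
  then show ?case
    using bounded_linear.continuous_on[OF assms(2)] by auto
next
  case (Suc k)
  show ?case
    by (rule Ck_on_SucI[OF assms(1), where f' = "\<lambda>x v. h (frechet_derivative f (at x) v)"])
      (auto intro!: bounded_linear.has_derivative[OF assms(2)] Suc.IH Ck_on_SucD[OF Suc.prems])
qed

lemma Ck_on_add:
  assumes "open S" "Ck_on k S f" "Ck_on k S g"
  shows "Ck_on k S (\<lambda>x. f x + g x)"
  using assms(2,3)
proof (induction k arbitrary: f g)
  case 0
  then show ?case by (auto intro: continuous_on_add)
next
  case (Suc k)
  show ?case
    by (rule Ck_on_SucI[OF assms(1),
          where f' = "\<lambda>x v. frechet_derivative f (at x) v + frechet_derivative g (at x) v"])
      (auto intro!: has_derivative_add Suc.IH Ck_on_SucD[OF Suc.prems(1)] Ck_on_SucD[OF Suc.prems(2)])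
qed

text \<open>One Leibniz induction serves multiplication and scaling alike. Each term leaves one
  factor undifferentiated, and that factor enters at the lower order.\<close>

lemma (in bounded_bilinear) Ck_on:
  assumes "open S" "Ck_on k S f" "Ck_on k S g"
  shows "Ck_on k S (\<lambda>x. prod (f x) (g x))"
  using assms(2,3)
proof (induction k arbitrary: f g)
  case 0
  then show ?case by (auto intro: continuous_on)
next
  case (Suc k)
  show ?case
    by (rule Ck_on_SucI[OF assms(1), where f' = "\<lambda>x v. prod (f x) (frechet_derivative g (at x) v)
          + prod (frechet_derivative f (at x) v) (g x)"])
      (auto intro!: FDERIV Ck_on_add[OF assms(1)] Suc.IH Suc.prems[THEN Ck_on_lower]
        Ck_on_SucD[OF Suc.prems(1)] Ck_on_SucD[OF Suc.prems(2)])
qed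

text \<open>The derivative of the inverse is a polynomial in the inverse itself and the derivative
  of \<open>f\<close>, so induction on the order with \<open>f\<close> fixed closes.\<close>

lemma Ck_on_inverse:
  fixes f :: "'a::euclidean_space \<Rightarrow> 'b::real_normed_field"
  assumes "open S" "Ck_on k S f" "\<And>x. x \<in> S \<Longrightarrow> f x \<noteq> 0"
  shows "Ck_on k S (\<lambda>x. inverse (f x))"
  using assms(2)
proof (induction k)
  case 0
  then show ?case using assms(3) by (auto intro: continuous_on_inverse)
next
  case (Suc k)
  note IH = Suc.IH[OF Ck_on_lower[OF Suc.prems]]
  note mult = bounded_bilinear.Ck_on[OF bounded_bilinear_mult assms(1)]
  have "Ck_on k S (\<lambda>x. - (inverse (f x) * frechet_derivative f (at x) v * inverse (f x)))" for v
    using Ck_on_compose_linear[OF assms(1) bounded_linear_minus[OF bounded_linear_ident]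
        mult[OF mult[OF IH Ck_on_SucD(2)[OF Suc.prems]] IH], of v] .
  then show ?case
    using Deriv.has_derivative_inverse[OF assms(3) Ck_on_SucD(1)[OF Suc.prems]]
    by (intro Ck_on_SucI[OF assms(1),
          where f' = "\<lambda>x v. - (inverse (f x) * frechet_derivative f (at x) v * inverse (f x))"])
qed

definition smooth_on :: "'a::euclidean_space set \<Rightarrow> ('a \<Rightarrow> 'b::real_normed_vector) \<Rightarrow> bool" where
  "smooth_on S f \<longleftrightarrow> (\<forall>k. Ck_on k S f)"

lemma smooth_on_has_derivative:
  "smooth_on S f \<Longrightarrow> x \<in> S \<Longrightarrow> (f has_derivative frechet_derivative f (at x)) (at x)"
  using Ck_on_SucD(1)[of 0] by (auto simp: smooth_on_def simp del: Ck_on.simps)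

lemma smooth_on_continuous: "smooth_on S f \<Longrightarrow> continuous_on S f"
  using Ck_on.simps(1) smooth_on_def by blast

lemma smooth_on_frechet_derivative:
  "smooth_on S f \<Longrightarrow> smooth_on S (\<lambda>x. frechet_derivative f (at x) v)"
  unfolding smooth_on_def by (blast intro: Ck_on_SucD(2))

lemma smooth_on_cong:
  "open S \<Longrightarrow> smooth_on S f \<Longrightarrow> (\<And>x. x \<in> S \<Longrightarrow> f x = g x) \<Longrightarrow> smooth_on S g"
  using Ck_on_cong by (metis smooth_on_def)

lemma smooth_on_subset: "smooth_on S f \<Longrightarrow> T \<subseteq> S \<Longrightarrow> smooth_on T f"
  unfolding smooth_on_def by (blast intro: Ck_on_subset)

lemma smooth_on_const: "open S \<Longrightarrow> smooth_on S (\<lambda>x. c)"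
  by (simp add: Ck_on_const smooth_on_def)

lemma smooth_on_bounded_linear: "open S \<Longrightarrow> bounded_linear f \<Longrightarrow> smooth_on S f"
  by (simp add: Ck_on_bounded_linear smooth_on_def)

lemma smooth_on_compose_linear:
  "open S \<Longrightarrow> bounded_linear h \<Longrightarrow> smooth_on S f \<Longrightarrow> smooth_on S (\<lambda>x. h (f x))"
  by (simp add: Ck_on_compose_linear smooth_on_def)

lemma smooth_on_add:
  "open S \<Longrightarrow> smooth_on S f \<Longrightarrow> smooth_on S g \<Longrightarrow> smooth_on S (\<lambda>x. f x + g x)"
  by (simp add: Ck_on_add smooth_on_def)

lemma smooth_on_sum:
  assumes "open S" "\<And>i. i \<in> I \<Longrightarrow> smooth_on S (f i)"
  shows "smooth_on S (\<lambda>x. \<Sum>i\<in>I. f i x)"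
  using assms(2)
  by (induction I rule: infinite_finite_induct) (simp_all add: assms(1) smooth_on_const smooth_on_add)

lemma (in bounded_bilinear) smooth_on:
  "open S \<Longrightarrow> smooth_on S f \<Longrightarrow> smooth_on S g \<Longrightarrow> smooth_on S (\<lambda>x. prod (f x) (g x))"
  by (simp add: Ck_on smooth_on_def)

lemma smooth_on_mult:
  fixes f g :: "'a::euclidean_space \<Rightarrow> 'b::real_normed_algebra"
  shows "open S \<Longrightarrow> smooth_on S f \<Longrightarrow> smooth_on S g \<Longrightarrow> smooth_on S (\<lambda>x. f x * g x)"
  by (rule bounded_bilinear.smooth_on[OF bounded_bilinear_mult])

lemma smooth_on_cmult:
  fixes F :: "'a::euclidean_space \<Rightarrow> 'b::real_normed_algebra"
  shows "open S \<Longrightarrow> smooth_on S F \<Longrightarrow> smooth_on S (\<lambda>z. c * F z)"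
  by (rule smooth_on_compose_linear[OF _ bounded_linear_mult_right])

lemma smooth_on_power:
  fixes f :: "'a::euclidean_space \<Rightarrow> 'b::real_normed_algebra_1"
  shows "open S \<Longrightarrow> smooth_on S f \<Longrightarrow> smooth_on S (\<lambda>x. f x ^ n)"
  by (induction n) (simp_all add: smooth_on_const smooth_on_mult)

lemma smooth_on_inverse:
  fixes f :: "'a::euclidean_space \<Rightarrow> 'b::real_normed_field"
  shows "open S \<Longrightarrow> smooth_on S f \<Longrightarrow> (\<And>x. x \<in> S \<Longrightarrow> f x \<noteq> 0) \<Longrightarrow> smooth_on S (\<lambda>x. inverse (f x))"
  by (simp add: Ck_on_inverse smooth_on_def)

lemma smooth_on_divide:
  fixes f g :: "'a::euclidean_space \<Rightarrow> 'b::real_normed_field"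
  shows "open S \<Longrightarrow> smooth_on S f \<Longrightarrow> smooth_on S g \<Longrightarrow> (\<And>x. x \<in> S \<Longrightarrow> g x \<noteq> 0)
    \<Longrightarrow> smooth_on S (\<lambda>x. f x / g x)"
  by (simp add: divide_inverse smooth_on_mult smooth_on_inverse)

section \<open>Complex matrices\<close>

text \<open>A derivative within \<open>W\<close> need not be unique as a linear map. Composition
  with a curve of velocity \<open>v\<close> gives a function of one real variable, whose derivative
  is unique. So any ambient extension may be used to evaluate the differential on tangent
  vectors.\<close>

lemma frechet_derivative_within_tangent:
  assumes "z \<in> W" "v \<in> tangent_space W z" "(U has_derivative U') (at z)"
    and "\<And>y. y \<in> W \<Longrightarrow> u y = U y"
  shows "frechet_derivative u (at z within W) v = U' v"
proof -
  have U: "(u has_derivative U') (at z within W)"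
    using has_derivative_transform[OF assms(1,4) has_derivative_at_withinI[OF assms(3)]] .
  then have D: "(u has_derivative frechet_derivative u (at z within W)) (at z within W)"
    using frechet_derivative_works by (auto simp: differentiable_def)
  from assms(2) obtain \<gamma> where \<gamma>: "\<And>t::real. \<gamma> t \<in> W" "\<gamma> 0 = z"
      "(\<gamma> has_derivative (\<lambda>t. t *\<^sub>R v)) (at 0)"
    by (auto simp: tangent_space_def has_vector_derivative_def)
  have "((\<lambda>t. u (\<gamma> t)) has_derivative (\<lambda>t. L (t *\<^sub>R v))) (at 0)"
    if "(u has_derivative L) (at z within W)" for L
    by (rule has_derivative_in_compose[OF \<gamma>(3)])
      (use has_derivative_subset[OF that, of "range \<gamma>"] \<gamma> in auto)
  from has_derivative_unique[OF this[OF D] this[OF U]] show ?thesis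
    by (metis scaleR_one)
qed

lemma has_derivative_vec_lambda:
  fixes f :: "'n::finite \<Rightarrow> 'a::real_normed_vector \<Rightarrow> 'b::euclidean_space"
  assumes "\<And>i. (f i has_derivative f' i) (at a within S)"
  shows "((\<lambda>x. \<chi> i. f i x) has_derivative (\<lambda>h. \<chi> i. f' i h)) (at a within S)"
  by (rule has_derivative_componentwise_within[THEN iffD2])
    (auto simp: Basis_vec_def inner_axis intro!: has_derivative_inner_left assms)

lemma matrix_add_rdistrib': "(A + B) ** C = A ** C + B ** (C :: 'a::semiring_1^'n^'m)"
  by (simp add: matrix_matrix_mult_def vec_eq_iff sum.distrib distrib_right)

lemma bounded_bilinear_matrix_mult:
  "bounded_bilinear ((**) :: complex^'n^'m \<Rightarrow> complex^'k^'n \<Rightarrow> complex^'k^'m)"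
  unfolding bilinear_conv_bounded_bilinear[symmetric] bilinear_def
  by (auto intro!: linearI simp: matrix_add_ldistrib matrix_add_rdistrib' matrix_scalar_ac
      scalar_matrix_assoc)

interpretation matrix_mult: bounded_bilinear
  "(**) :: complex^'n^'m \<Rightarrow> complex^'k^'n \<Rightarrow> complex^'k^'m"
  by (rule bounded_bilinear_matrix_mult)

lemma conj_transpose_component [simp]: "conj_transpose A $ i $ j = cnj (A $ j $ i)"
  by (simp add: conj_transpose_def transpose_def)

lemma conj_transpose_mult: "conj_transpose (A ** B) = conj_transpose B ** conj_transpose A"
  by (simp add: vec_eq_iff matrix_matrix_mult_def mult.commute)

lemma conj_transpose_conj_transpose [simp]: "conj_transpose (conj_transpose A) = A"
  by (simp add: vec_eq_iff)

lemma conj_transpose_mat [simp]: "conj_transpose (mat c) = mat (cnj c)"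
  by (simp add: vec_eq_iff mat_def)

lemma linear_conj_transpose: "linear conj_transpose"
  by (intro linearI) (auto simp: vec_eq_iff)

lemmas bounded_linear_conj_transpose = linear_conj_transpose[unfolded linear_conv_bounded_linear]

lemma inner_matrix: "A \<bullet> B = Re (trace (A ** conj_transpose B))" for A B :: "complex^'n^'m"
  by (simp add: inner_vec_def trace_def matrix_matrix_mult_def inner_complex_def)

lemma inner_conj_transpose: "conj_transpose A \<bullet> conj_transpose B = A \<bullet> B"
  for A B :: "complex^'n^'m"
  unfolding inner_vec_def by (subst sum.swap) (simp add: inner_complex_def)

lemma inner_matrix_mult_left: "(A ** X) \<bullet> Y = X \<bullet> (conj_transpose A ** Y)"
  for A :: "complex^'n^'m" and X :: "complex^'k^'n"
  by (simp add: inner_matrix conj_transpose_mult trace_mul_sym[of "A ** X"] matrix_mul_assoc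
      trace_mul_sym[of "X ** conj_transpose Y"])

lemma matrix_inv_unique:
  fixes A B :: "'a::semiring_1^'n^'n"
  assumes "A ** B = mat 1" "B ** A = mat 1"
  shows "matrix_inv A = B"
proof -
  have "A ** matrix_inv A = mat 1 \<and> matrix_inv A ** A = mat 1"
    unfolding matrix_inv_def by (rule someI[of _ B]) (simp add: assms)
  then show ?thesis
    by (metis assms(2) matrix_mul_assoc matrix_mul_lid matrix_mul_rid)
qed

lemma has_derivative_det:
  fixes M :: "'a::real_normed_vector \<Rightarrow> complex^'n^'n"
  assumes "(M has_derivative M') (at x within S)"
  shows "((\<lambda>x. det (M x)) has_derivative
    (\<lambda>h. \<Sum>p | p permutes UNIV. of_int (sign p) *
      (\<Sum>i\<in>UNIV. M' h $ i $ p i * (\<Prod>j\<in>UNIV - {i}. M x $ j $ p j)))) (at x within S)"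
proof -
  have "((\<lambda>x. M x $ i $ j) has_derivative (\<lambda>h. M' h $ i $ j)) (at x within S)" for i j
    using bounded_linear.has_derivative[OF bounded_linear_vec_nth
        bounded_linear.has_derivative[OF bounded_linear_vec_nth assms]] .
  then show ?thesis
    unfolding det_def
    by (intro has_derivative_sum has_derivative_mult_right has_derivative_prod)
qed

text \<open>A permutation other than the identity moves at least two indices. Each of its terms
  therefore keeps an off-diagonal zero of the identity matrix after one factor has been
  differentiated, and only the diagonal product contributes.\<close>

lemma has_derivative_det_at_mat_1:
  fixes M :: "'a::real_normed_vector \<Rightarrow> complex^'n^'n"
  assumes "(M has_derivative M') (at x within S)" "M x = mat 1"
  shows "((\<lambda>x. det (M x)) has_derivative (\<lambda>h. trace (M' h))) (at x within S)"
proof -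
  let ?t = "\<lambda>h p. of_int (sign p) *
    (\<Sum>i\<in>UNIV. M' h $ i $ p i * (\<Prod>j\<in>UNIV - {i}. M x $ j $ p j))"
  have "(\<Sum>p | p permutes UNIV. ?t h p) = trace (M' h)" for h
  proof -
    have "?t h p = 0" if p: "p permutes UNIV" "p \<noteq> id" for p
    proof -
      have "\<exists>j\<in>UNIV - {i}. p j \<noteq> j" for i
      proof (rule ccontr)
        assume *: "\<not> (\<exists>j\<in>UNIV - {i}. p j \<noteq> j)"
        then have "p i = i"
          using permutes_inj[OF p(1)] by (metis Diff_iff UNIV_I injD singletonD)
        with * p(2) show False by (auto simp: fun_eq_iff)
      qed
      then have "(\<Prod>j\<in>UNIV - {i}. M x $ j $ p j) = 0" for i
        using assms(2) by (intro prod_zero) (simp_all add: mat_def, metis)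
      then show ?thesis by (simp only: mult_zero_right sum.neutral_const)
    qed
    then have "(\<Sum>p | p permutes UNIV. ?t h p) = (\<Sum>p\<in>{id}. ?t h p)"
      by (intro sum.mono_neutral_right) (auto simp: permutes_id finite_permutations)
    also have "\<dots> = trace (M' h)"
      using assms(2) by (simp add: trace_def mat_def)
    finally show ?thesis .
  qed
  with has_derivative_det[OF assms(1)] show ?thesis by simp
qed

text \<open>By Cramer's rule the entries of the inverse are quotients of determinants on the open
  set of nonzero determinant; \<open>C k l\<close> provides the numerators. This is needed for the
  Christoffel symbols, which differentiate the metric in all ambient directions, and for the Cayley
  transform.\<close>

lemma matrix_inv_differentiable:
  fixes z :: "complex^'n^'n"
  assumes "invertible z"
  shows "matrix_inv differentiable (at z)"
proof -
  define C :: "'n \<Rightarrow> 'n \<Rightarrow> complex^'n^'n \<Rightarrow> complex^'n^'n"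
    where "C k l y = (\<chi> i j. if j = k then mat 1 $ i $ l else y $ i $ j)" for k l y
  have C: "(C k l has_derivative (\<lambda>v. \<chi> i j. if j = k then 0 else v $ i $ j)) (at y)" for k l y
  proof -
    have "((\<lambda>y. C k l 0 + (\<chi> i j. if j = k then 0 else y $ i $ j)) has_derivative
      (\<lambda>v. \<chi> i j. if j = k then 0 else v $ i $ j)) (at y)"
      by (rule has_derivative_const[THEN has_derivative_add, THEN has_derivative_eq_rhs,
            OF bounded_linear_imp_has_derivative])
        (auto simp: linear_conv_bounded_linear[symmetric] vec_eq_iff intro!: linearI)
    moreover have "(\<lambda>y. C k l 0 + (\<chi> i j. if j = k then 0 else y $ i $ j)) = C k l"
      by (auto simp: C_def vec_eq_iff fun_eq_iff)
    ultimately show ?thesis by simp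
  qed
  have dC: "(\<lambda>y. det (C k l y)) differentiable (at y)" for k l y
    using has_derivative_det[OF C] by (auto simp: differentiable_def)
  have dd: "(\<lambda>y. det y) differentiable (at y)" for y :: "complex^'n^'n"
    using has_derivative_det[OF has_derivative_ident] by (auto simp: differentiable_def)
  define I where "I y = (\<chi> k l. det (C k l y) / det y)" for y
  have I: "matrix_inv y = I y" if y: "det y \<noteq> 0" for y
  proof -
    obtain B where B: "y ** B = mat 1" "B ** y = mat 1"
      using y invertible_det_nz[of y] unfolding invertible_def by blast
    have "column l B = (\<chi> k. det (C k l y) / det y)" for l
    proof -
      have "y *v column l B = column l (mat 1)"
        by (simp add: B(1)[symmetric] column_def matrix_vector_mult_def matrix_matrix_mult_def vec_eq_iff)
      with cramer[OF y, of "column l B" "column l (mat 1)"] show ?thesis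
        by (simp add: C_def column_def cong: if_cong)
    qed
    then have "B = I y"
      by (simp add: I_def vec_eq_iff column_def)
    with matrix_inv_unique[OF B] show ?thesis by simp
  qed
  have nz: "det z \<noteq> 0"
    using assms invertible_det_nz by blast
  have "I differentiable (at z)"
  proof -
    have "(\<lambda>y. det (C k l y) / det y) differentiable (at z)" for k l
      using dC dd nz by (intro differentiable_divide) auto
    then obtain D where D: "\<And>k l. ((\<lambda>y. det (C k l y) / det y) has_derivative D k l) (at z)"
      unfolding differentiable_def by metis
    have "(I has_derivative (\<lambda>v. \<chi> k l. D k l v)) (at z)"
      unfolding I_def by (intro has_derivative_vec_lambda D)
    then show ?thesis by (auto simp: differentiable_def)
  qed
  moreover have "open {y :: complex^'n^'n. det y \<noteq> 0}"
  proof -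
    have "continuous_on UNIV (det :: complex^'n^'n \<Rightarrow> complex)"
      using dd differentiable_imp_continuous_within continuous_at_imp_continuous_on by blast
    then show ?thesis
      using open_Collect_neq[of det "\<lambda>_. 0"] by auto
  qed
  ultimately show ?thesis
    using has_derivative_transform_within_open[of I _ z UNIV "{y. det y \<noteq> 0}" matrix_inv] I nz
    by (auto simp: differentiable_def)
qed

section \<open>Laplacian on left-translated submanifolds of the unitary group\<close>

lemma unitaryD:
  assumes "z \<in> unitary_group"
  shows "z ** conj_transpose z = mat 1" "conj_transpose z ** z = mat 1"
    "conj_transpose z ** (z ** A) = A" "z ** (conj_transpose z ** A) = A"
    "matrix_inv z = conj_transpose z" "invertible z"
proof -
  show *: "z ** conj_transpose z = mat 1" "conj_transpose z ** z = mat 1"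
    using assms by (auto simp: unitary_group_def)
  then show "conj_transpose z ** (z ** A) = A" "z ** (conj_transpose z ** A) = A"
    by (simp_all add: matrix_mul_assoc)
  show "matrix_inv z = conj_transpose z"
    using * by (rule matrix_inv_unique)
  show "invertible z"
    using * by (auto simp: invertible_def)
qed

lemma inner_unitary_mult:
  "z \<in> unitary_group \<Longrightarrow> (z ** A) \<bullet> (z ** B) = A \<bullet> B"
  by (simp add: inner_matrix_mult_left unitaryD(3))

lemma GL_metric_eq_inner_matrix_inv: "GL_metric z A B = (matrix_inv z ** A) \<bullet> (matrix_inv z ** B)"
  by (simp add: GL_metric_def inner_matrix)

lemma GL_metric_unitary: "z \<in> unitary_group \<Longrightarrow> GL_metric z A B = A \<bullet> B"
  by (simp add: GL_metric_eq_inner_matrix_inv unitaryD(5) inner_matrix_mult_left unitaryD(4))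

lemma GL_metric_differentiable:
  assumes "invertible z"
  shows "(\<lambda>y. GL_metric y A B) differentiable (at z)"
proof -
  obtain D where D: "(matrix_inv has_derivative D) (at z)"
    using matrix_inv_differentiable[OF assms] by (auto simp: differentiable_def)
  have "((\<lambda>y. matrix_inv y ** A) has_derivative (\<lambda>v. D v ** A)) (at z)" for A
    using bounded_linear.has_derivative[OF matrix_mult.bounded_linear_left D] .
  from has_derivative_inner[OF this this] show ?thesis
    unfolding GL_metric_eq_inner_matrix_inv differentiable_def by blast
qed

text \<open>\<open>conj_transpose A ** A\<close> is hermitian, and skew-hermitian matrices are
  orthogonal to hermitian ones. This removes the contribution of the moving left-invariant frame
  from the divergence.\<close>

lemma skew_inner_mult_left:
  assumes "conj_transpose A = - A" "conj_transpose C = - C"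
  shows "(A ** C) \<bullet> A = 0"
proof -
  define D where "D = conj_transpose A ** A"
  have "(A ** C) \<bullet> A = C \<bullet> D"
    by (simp add: D_def inner_matrix_mult_left)
  also have "\<dots> = conj_transpose C \<bullet> conj_transpose D"
    by (simp add: inner_conj_transpose)
  also have "\<dots> = - (C \<bullet> D)"
    by (simp add: assms(2) D_def conj_transpose_mult)
  finally show ?thesis
    using \<open>(A ** C) \<bullet> A = C \<bullet> D\<close> by simp
qed

text \<open>\<open>riem_div\<close> sums over a basis picked by choice; this exchanges it for the
  left-invariant frame. \<open>L\<close> may leave \<open>T\<close>, since only its compression to
  \<open>T\<close> enters the sums.\<close>

lemma trace_orthonormal_basis_invariant:
  fixes L :: "'a::euclidean_space \<Rightarrow> 'a"
  assumes L: "linear L"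
    and B: "finite B" "B \<subseteq> T" "\<And>x. x \<in> T \<Longrightarrow> (\<Sum>e\<in>B. (x \<bullet> e) *\<^sub>R e) = x"
    and C: "finite C" "C \<subseteq> T" "\<And>x. x \<in> T \<Longrightarrow> (\<Sum>e\<in>C. (x \<bullet> e) *\<^sub>R e) = x"
  shows "(\<Sum>e\<in>B. L e \<bullet> e) = (\<Sum>e\<in>C. L e \<bullet> e)"
proof -
  have "(\<Sum>e\<in>B. L e \<bullet> e) = (\<Sum>e\<in>B. \<Sum>c\<in>C. (L c \<bullet> e) * (e \<bullet> c))"
  proof (intro sum.cong refl)
    fix e assume "e \<in> B"
    then have "L e = L (\<Sum>c\<in>C. (e \<bullet> c) *\<^sub>R c)"
      using B(2) C(3) by auto
    then show "L e \<bullet> e = (\<Sum>c\<in>C. (L c \<bullet> e) * (e \<bullet> c))"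
      by (simp add: linear_sum[OF L] linear_cmul[OF L] inner_sum_left mult.commute)
  qed
  also have "\<dots> = (\<Sum>c\<in>C. L c \<bullet> (\<Sum>e\<in>B. (c \<bullet> e) *\<^sub>R e))"
    by (subst sum.swap) (simp add: inner_sum_right mult.commute inner_commute)
  also have "\<dots> = (\<Sum>c\<in>C. L c \<bullet> c)"
    using B(3) C(2) by (intro sum.cong) auto
  finally show ?thesis .
qed

lemma orthonormal_finite_expand:
  fixes B :: "'a::euclidean_space set"
  assumes "\<And>e e'. e \<in> B \<Longrightarrow> e' \<in> B \<Longrightarrow> e \<bullet> e' = (if e = e' then 1 else 0)"
  shows "finite B" "x \<in> span B \<Longrightarrow> (\<Sum>e\<in>B. (x \<bullet> e) *\<^sub>R e) = x"
proof -
  have orth: "pairwise orthogonal B"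
    using assms by (auto simp: pairwise_def orthogonal_def)
  have norm: "norm e = 1" if "e \<in> B" for e
    using assms[OF that that] by (simp add: norm_eq_1)
  show fin: "finite B"
    using pairwise_orthogonal_independent[OF orth] norm independent_imp_finite by force
  show "(\<Sum>e\<in>B. (x \<bullet> e) *\<^sub>R e) = x" if "x \<in> span B"
    using orthonormal_basis_expand[OF orth norm that fin] .
qed

text \<open>Derivative along the left-invariant vector field of \<open>A\<close>. The same formula
  extends the field to all matrices, so that Lie derivatives of ambient functions can be
  iterated.\<close>

definition lie_deriv ::
    "complex^'n^'n \<Rightarrow> (complex^'n^'n \<Rightarrow> 'b::real_normed_vector) \<Rightarrow> complex^'n^'n \<Rightarrow> 'b" where
  "lie_deriv A F z = frechet_derivative F (at z) (z ** A)"

lemma lie_deriv_eqI: "(F has_derivative F') (at z) \<Longrightarrow> lie_deriv A F z = F' (z ** A)"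
  unfolding lie_deriv_def by (metis frechet_derivative_at)

lemma lie_deriv_cong:
  "open U \<Longrightarrow> z \<in> U \<Longrightarrow> (\<And>y. y \<in> U \<Longrightarrow> F y = G y) \<Longrightarrow> lie_deriv A F z = lie_deriv A G z"
  unfolding lie_deriv_def using frechet_derivative_cong_open[of U z F G] by simp

lemma lie_deriv_compose_linear:
  assumes "bounded_linear h" "(F has_derivative F') (at z)"
  shows "lie_deriv A (\<lambda>y. h (F y)) z = h (lie_deriv A F z)"
  using lie_deriv_eqI[OF bounded_linear.has_derivative[OF assms]] lie_deriv_eqI[OF assms(2)] by metis

text \<open>The direction \<open>z ** A\<close> moves with \<open>z\<close>. Expanding it in the
  fixed basis leaves derivatives in constant directions, with coefficients linear in
  \<open>z\<close>.\<close>

lemma smooth_on_lie_deriv: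
  assumes "open U" "smooth_on U F"
  shows "smooth_on U (lie_deriv A F)"
proof -
  have "smooth_on U (\<lambda>z. (z ** A) \<bullet> b)" for b
    by (rule smooth_on_bounded_linear[OF assms(1)
        bounded_linear_compose[OF bounded_linear_inner_left matrix_mult.bounded_linear_left]])
  then have "smooth_on U (\<lambda>z. \<Sum>b\<in>Basis. ((z ** A) \<bullet> b) *\<^sub>R frechet_derivative F (at z) b)"
    using assms smooth_on_frechet_derivative
    by (intro smooth_on_sum bounded_bilinear.smooth_on[OF bounded_bilinear_scaleR])
  then show ?thesis
  proof (rule smooth_on_cong[OF assms(1)])
    fix z assume "z \<in> U"
    then have lin: "linear (frechet_derivative F (at z))"
      using smooth_on_has_derivative[OF assms(2)] has_derivative_linear by blast
    have "lie_deriv A F z = frechet_derivative F (at z) (\<Sum>b\<in>Basis. ((z ** A) \<bullet> b) *\<^sub>R b)"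
      by (simp add: lie_deriv_def euclidean_representation)
    then show "(\<Sum>b\<in>Basis. ((z ** A) \<bullet> b) *\<^sub>R frechet_derivative F (at z) b) = lie_deriv A F z"
      by (simp add: linear_sum[OF lin] linear_cmul[OF lin])
  qed
qed

text \<open>Common setting for U(n) and relatively open parts of SU(n): \<open>S\<close> is the Lie
  algebra, and the left translates of \<open>B\<close> form a global orthonormal frame of
  \<open>W\<close>.\<close>

locale left_translated =
  fixes W S B :: "(complex^'n^'n) set"
  assumes W_unitary: "W \<subseteq> unitary_group"
    and tangent: "\<And>z. z \<in> W \<Longrightarrow> tangent_space W z = (\<lambda>A. z ** A) ` S"
    and skew: "\<And>A. A \<in> S \<Longrightarrow> conj_transpose A = - A"
    and span_B: "span B = S"
    and orthonormal: "\<And>A C. A \<in> B \<Longrightarrow> C \<in> B \<Longrightarrow> A \<bullet> C = (if A = C then 1 else 0)"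
begin

lemma finite_B: "finite B"
  using orthonormal by (rule orthonormal_finite_expand(1))

lemma expand_B: "x \<in> S \<Longrightarrow> (\<Sum>A\<in>B. (x \<bullet> A) *\<^sub>R A) = x"
  using orthonormal_finite_expand(2)[of B x] orthonormal by (simp add: span_B)

lemma B_subset: "A \<in> B \<Longrightarrow> A \<in> S"
  using span_B span_base by blast

lemma subspace_S: "subspace S"
  using span_B subspace_span by metis

lemma unitary: "z \<in> W \<Longrightarrow> z \<in> unitary_group"
  using W_unitary by blast

lemma mult_in_tangent: "z \<in> W \<Longrightarrow> A \<in> S \<Longrightarrow> z ** A \<in> tangent_space W z"
  by (simp add: tangent)

lemma subspace_tangent: "z \<in> W \<Longrightarrow> subspace (tangent_space W z)"
  using linear_subspace_image[OF bounded_linear.linear[OF matrix_mult.bounded_linear_right] subspace_S]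
  by (simp add: tangent)

lemma tangent_expand:
  assumes "z \<in> W" "v \<in> tangent_space W z"
  shows "(\<Sum>A\<in>B. (v \<bullet> (z ** A)) *\<^sub>R (z ** A)) = v"
proof -
  obtain C where C: "C \<in> S" "v = z ** C"
    using assms tangent by auto
  have "(\<Sum>A\<in>B. (v \<bullet> (z ** A)) *\<^sub>R (z ** A)) = z ** (\<Sum>A\<in>B. (C \<bullet> A) *\<^sub>R A)"
    using unitary[OF assms(1)]
    by (simp add: C inner_unitary_mult matrix_mult.sum_right matrix_mult.scaleR_right)
  with C expand_B show ?thesis by simp
qed

lemma tangent_eqI:
  assumes "z \<in> W" "X \<in> tangent_space W z" "Y \<in> tangent_space W z"
    and "\<And>v. v \<in> tangent_space W z \<Longrightarrow> X \<bullet> v = Y \<bullet> v"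
  shows "X = Y"
proof -
  have "(X - Y) \<bullet> (X - Y) = 0"
    using assms(4)[OF subspace_diff[OF subspace_tangent[OF assms(1)] assms(2,3)]]
    by (simp add: inner_diff_left)
  then show ?thesis by simp
qed

lemma sum_in_tangent: "z \<in> W \<Longrightarrow> (\<Sum>A\<in>B. r A *\<^sub>R (z ** A)) \<in> tangent_space W z"
  by (intro subspace_sum subspace_scale subspace_tangent mult_in_tangent B_subset)

text \<open>The sum is the Riesz representative of \<open>L\<close> on the tangent space. Gradients
  and tangential projections are both of this kind.\<close>

lemma sum_inner_tangent:
  assumes "z \<in> W" "v \<in> tangent_space W z" "linear L"
  shows "(\<Sum>A\<in>B. L (z ** A) *\<^sub>R (z ** A)) \<bullet> v = (L v :: real)"
proof -
  have "L v = L (\<Sum>A\<in>B. (v \<bullet> (z ** A)) *\<^sub>R (z ** A))"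
    using tangent_expand[OF assms(1,2)] by simp
  then show ?thesis
    by (subst inner_commute)
      (simp add: linear_sum[OF assms(3)] linear_cmul[OF assms(3)] inner_sum_right mult.commute)
qed

lemma riem_grad_eq:
  assumes z: "z \<in> W" and U: "(U has_derivative U') (at z)" and u: "\<And>y. y \<in> W \<Longrightarrow> u y = U y"
  shows "riem_grad GL_metric W u z = (\<Sum>A\<in>B. U' (z ** A) *\<^sub>R (z ** A))"
  unfolding riem_grad_def
proof (rule the_equality, intro conjI ballI)
  let ?X = "\<Sum>A\<in>B. U' (z ** A) *\<^sub>R (z ** A)"
  show X: "?X \<in> tangent_space W z"
    by (rule sum_in_tangent[OF z])
  show *: "GL_metric z ?X v = frechet_derivative u (at z within W) v"
    if "v \<in> tangent_space W z" for v
    using frechet_derivative_within_tangent[OF z that U u]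
      sum_inner_tangent[OF z that has_derivative_linear[OF U]]
    by (simp add: GL_metric_unitary[OF unitary[OF z]])
  show "Y = ?X" if Y: "Y \<in> tangent_space W z \<and>
      (\<forall>v\<in>tangent_space W z. GL_metric z Y v = frechet_derivative u (at z within W) v)" for Y
    using Y * X by (intro tangent_eqI[OF z]) (auto simp flip: GL_metric_unitary[OF unitary[OF z]])
qed

lemma tangent_proj_inner:
  assumes z: "z \<in> W" and v: "v \<in> tangent_space W z"
  shows "tangent_proj GL_metric W z x \<bullet> v = x \<bullet> v"
proof -
  let ?t = "\<Sum>A\<in>B. (x \<bullet> (z ** A)) *\<^sub>R (z ** A)"
  have t: "?t \<in> tangent_space W z" "\<And>v. v \<in> tangent_space W z \<Longrightarrow> ?t \<bullet> v = x \<bullet> v"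
    using sum_in_tangent[OF z] sum_inner_tangent[OF z, of _ "\<lambda>v. x \<bullet> v"]
    by (auto simp: bounded_linear.linear[OF bounded_linear_inner_right])
  have "tangent_proj GL_metric W z x = ?t"
    unfolding tangent_proj_def
    by (rule the_equality) (use t tangent_eqI[OF z] in \<open>auto simp: GL_metric_unitary[OF unitary[OF z]]\<close>)
  with t v show ?thesis by simp
qed

text \<open>The metric is constant along \<open>W\<close>, so the Koszul formula leaves no contribution of the
  Christoffel symbols to the divergence of tangential fields.\<close>

lemma christoffel_inner:
  assumes z: "z \<in> W" and w: "w \<in> tangent_space W z"
  shows "christoffel GL_metric z v w \<bullet> v = 0"
proof -
  note inner_z = GL_metric_unitary[OF unitary[OF z]]
  let ?D = "\<lambda>a b. frechet_derivative (\<lambda>y. GL_metric y a b) (at z)"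
  have D: "((\<lambda>y. GL_metric y a b) has_derivative ?D a b) (at z)" for a b
    by (rule frechet_derivative_works[THEN iffD1, OF GL_metric_differentiable[OF unitaryD(6)[OF unitary[OF z]]]])
  have add: "?D a (b + c) v = ?D a b v + ?D a c v" for a b c v
  proof -
    have "(\<lambda>y. GL_metric y a (b + c)) = (\<lambda>y. GL_metric y a b + GL_metric y a c)"
      by (simp add: GL_metric_eq_inner_matrix_inv matrix_add_ldistrib inner_add_right)
    then have "((\<lambda>y. GL_metric y a (b + c)) has_derivative (\<lambda>v. ?D a b v + ?D a c v)) (at z)"
      by (simp only:) (rule has_derivative_add[OF D D])
    from has_derivative_unique[OF D this] show ?thesis
      by (rule fun_cong)
  qed
  have scale: "?D a (r *\<^sub>R b) v = r * ?D a b v" for a r b v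
  proof -
    have "(\<lambda>y. GL_metric y a (r *\<^sub>R b)) = (\<lambda>y. r * GL_metric y a b)"
      by (simp add: GL_metric_eq_inner_matrix_inv matrix_mult.scaleR_right)
    then have "((\<lambda>y. GL_metric y a (r *\<^sub>R b)) has_derivative (\<lambda>v. r * ?D a b v)) (at z)"
      by (simp only:) (rule has_derivative_mult_right[OF D])
    from has_derivative_unique[OF D this] show ?thesis
      by (rule fun_cong)
  qed
  have comm: "?D a b = ?D b a" for a b
    by (simp add: GL_metric_eq_inner_matrix_inv inner_commute)
  define K where "K x = ?D w x v + ?D v x w - ?D v w x" for x
  have "linear K"
    unfolding K_def
    by (intro linearI)
      (auto simp: add scale linear_add[OF has_derivative_linear[OF D]]
        linear_cmul[OF has_derivative_linear[OF D]] algebra_simps)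
  \<comment> \<open>Riesz representative of half of \<open>K\<close>: at \<open>z\<close> the metric
    is the Euclidean inner product, so this vector solves the Koszul formula.\<close>
  define u where "u = (\<Sum>b\<in>Basis. (K b / 2) *\<^sub>R b)"
  have u: "2 * (u \<bullet> x) = K x" for x
  proof -
    have "K x = K (\<Sum>b\<in>Basis. (x \<bullet> b) *\<^sub>R b)"
      by (simp add: euclidean_representation)
    then show ?thesis
      by (simp add: u_def linear_sum[OF \<open>linear K\<close>] linear_cmul[OF \<open>linear K\<close>] inner_sum_left
          sum_distrib_left inner_commute[of x] mult.commute)
  qed
  have "christoffel GL_metric z v w = u"
    unfolding christoffel_def
  proof (rule the_equality)
    show "\<forall>x. 2 * GL_metric z u x = ?D w x v + ?D v x w - ?D v w x"
      using u by (simp add: inner_z K_def)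
    show "y = u" if "\<forall>x. 2 * GL_metric z y x = ?D w x v + ?D v x w - ?D v w x" for y
    proof -
      have "y \<bullet> x = u \<bullet> x" for x
        using that[unfolded inner_z, rule_format, of x] u[of x, unfolded K_def] by linarith
      then show ?thesis
        by (rule euclidean_eqI)
    qed
  qed
  \<comment> \<open>At \<open>x = v\<close> the first and the third Koszul term cancel by symmetry
    of the metric.\<close>
  moreover have "K v = ?D v v w"
    unfolding K_def comm[of w v] by simp
  moreover have "?D v v w = 0"
  proof -
    have "v \<bullet> v = GL_metric y v v" if "y \<in> W" for y
      by (simp only: GL_metric_unitary[OF unitary[OF that]])
    from frechet_derivative_within_tangent[OF z w D this]
      frechet_derivative_within_tangent[OF z w has_derivative_const refl]
    show ?thesis by metis
  qed
  ultimately show ?thesis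
    using u[of v] by simp
qed

text \<open>In the left-invariant frame the gradient has the coefficients
  \<open>lie_deriv A U\<close>. Differentiating the coefficients yields the iterated Lie
  derivatives; differentiating the frame yields terms \<open>(A ** C) \<bullet> A\<close>, which
  vanish by skewness.\<close>

lemma riem_div_riem_grad:
  assumes z: "z \<in> W" and "open \<Omega>" "W \<subseteq> \<Omega>" and U: "smooth_on \<Omega> U"
    and u: "\<And>y. y \<in> W \<Longrightarrow> u y = U y"
  shows "riem_div GL_metric W (riem_grad GL_metric W u) z = (\<Sum>A\<in>B. lie_deriv A (lie_deriv A U) z)"
proof -
  let ?T = "tangent_space W z"
  define Y where "Y y = (\<Sum>A\<in>B. lie_deriv A U y *\<^sub>R (y ** A))" for y
  define Y' where "Y' v = (\<Sum>A\<in>B. lie_deriv A U z *\<^sub>R (v ** A) +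
      frechet_derivative (lie_deriv A U) (at z) v *\<^sub>R (z ** A))" for v
  have Y: "riem_grad GL_metric W u y = Y y" if "y \<in> W" for y
    using riem_grad_eq[OF that smooth_on_has_derivative[OF U] u] that assms(3)
    by (auto simp: Y_def lie_deriv_def)
  have Y': "(Y has_derivative Y') (at z)"
    unfolding Y_def Y'_def
    using z assms(3)
    by (intro has_derivative_sum has_derivative_scaleR
        smooth_on_has_derivative[OF smooth_on_lie_deriv[OF assms(2) U]]
        bounded_linear_imp_has_derivative matrix_mult.bounded_linear_left) auto
  have grad: "riem_grad GL_metric W u z \<in> ?T"
    unfolding Y[OF z] Y_def by (rule sum_in_tangent[OF z])
  have lc: "GL_metric z (levi_civita GL_metric W (riem_grad GL_metric W u) z e) e = Y' e \<bullet> e"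
    if "e \<in> ?T" for e
    using frechet_derivative_within_tangent[OF z that Y' Y] christoffel_inner[OF z grad]
    by (simp add: GL_metric_unitary[OF unitary[OF z]] levi_civita_def tangent_proj_inner[OF z that]
        inner_add_left)
  have img: "(\<lambda>A. z ** A) ` B \<subseteq> ?T"
    using mult_in_tangent[OF z] B_subset by auto
  have inj: "inj_on (\<lambda>A. z ** A) B"
    by (metis inj_onI unitaryD(3)[OF unitary[OF z]])
  have spn: "span ((\<lambda>A. z ** A) ` B) = ?T"
    using linear_span_image[OF bounded_linear.linear[OF matrix_mult.bounded_linear_right], of z B]
    by (simp add: tangent[OF z] span_B)
  define E where "E = (SOME C. orthonormal_basis_of (GL_metric z) ?T C)"
  \<comment> \<open>The choice inside \<open>riem_div\<close> yields an orthonormal basis only once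
    a witness is known.\<close>
  have onb: "orthonormal_basis_of (GL_metric z) ?T ((\<lambda>A. z ** A) ` B)"
    unfolding orthonormal_basis_of_def
    using img inj spn orthonormal unitary[OF z]
    by (auto simp: GL_metric_unitary inner_unitary_mult inj_on_eq_iff)
  have "orthonormal_basis_of (GL_metric z) ?T E"
    unfolding E_def using onb by (rule someI)
  then have *: "E \<subseteq> ?T \<and> span E = ?T \<and> (\<forall>e\<in>E. \<forall>e'\<in>E. e \<bullet> e' = (if e = e' then 1 else 0))"
    unfolding orthonormal_basis_of_def GL_metric_unitary[OF unitary[OF z]] .
  note E = *[THEN conjunct1] *[THEN conjunct2, THEN conjunct1]
  have E_orth: "e \<bullet> e' = (if e = e' then 1 else 0)" if "e \<in> E" "e' \<in> E" for e e'
    using *[THEN conjunct2, THEN conjunct2, rule_format, OF that] .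
  have "riem_div GL_metric W (riem_grad GL_metric W u) z = (\<Sum>e\<in>E. Y' e \<bullet> e)"
    unfolding riem_div_def E_def[symmetric] by (intro sum.cong refl lc subsetD[OF E(1)])
  also have "\<dots> = (\<Sum>e\<in>(\<lambda>A. z ** A) ` B. Y' e \<bullet> e)"
  proof (rule trace_orthonormal_basis_invariant)
    show "linear Y'"
      using Y' has_derivative_linear by blast
    show "finite E"
      using E_orth by (rule orthonormal_finite_expand(1))
    show "(\<Sum>e\<in>E. (x \<bullet> e) *\<^sub>R e) = x" if "x \<in> ?T" for x
      using E_orth that[folded E(2)] by (rule orthonormal_finite_expand(2))
    show "E \<subseteq> ?T"
      by (rule E(1))
    show "finite ((\<lambda>A. z ** A) ` B)" "(\<lambda>A. z ** A) ` B \<subseteq> ?T"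
      using finite_B img by auto
    show "(\<Sum>e\<in>(\<lambda>A. z ** A) ` B. (x \<bullet> e) *\<^sub>R e) = x" if "x \<in> ?T" for x
      using tangent_expand[OF z that] by (simp add: sum.reindex[OF inj])
  qed
  also have "\<dots> = (\<Sum>A\<in>B. Y' (z ** A) \<bullet> (z ** A))"
    by (simp add: sum.reindex[OF inj])
  also have "\<dots> = (\<Sum>A\<in>B. lie_deriv A (lie_deriv A U) z)"
  proof (intro sum.cong refl)
    fix A assume A: "A \<in> B"
    have "Y' (z ** A) \<bullet> (z ** A) = (\<Sum>C\<in>B. lie_deriv C U z * ((A ** C) \<bullet> A) +
      lie_deriv A (lie_deriv C U) z * (C \<bullet> A))"
      unfolding Y'_def inner_sum_left inner_add_left inner_scaleR_left
        inner_unitary_mult[OF unitary[OF z]] matrix_mul_assoc[symmetric] lie_deriv_def ..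
    also have "\<dots> = (\<Sum>C\<in>B. if C = A then lie_deriv A (lie_deriv A U) z else 0)"
      using A by (intro sum.cong refl) (auto simp: orthonormal skew_inner_mult_left skew B_subset)
    also have "\<dots> = lie_deriv A (lie_deriv A U) z"
      using A finite_B by simp
    finally show "Y' (z ** A) \<bullet> (z ** A) = lie_deriv A (lie_deriv A U) z" .
  qed
  finally show ?thesis .
qed

text \<open>Agreement of \<open>f\<close> and \<open>F\<close> is asked for on \<open>W\<close>
  alone. So the rule applies again to a function that is itself a value of \<open>tau\<close>, which
  is how the iterated operator is reached.\<close>

lemma tau_eq:
  assumes z: "z \<in> W" and W_sub: "open \<Omega>" "W \<subseteq> \<Omega>" and F: "smooth_on \<Omega> F"
    and f: "\<And>y. y \<in> W \<Longrightarrow> f y = F y"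
  shows "tau GL_metric W f z = (\<Sum>A\<in>B. lie_deriv A (lie_deriv A F) z)"
proof -
  have *: "riem_div GL_metric W (riem_grad GL_metric W (\<lambda>y. h (f y))) z =
      h (\<Sum>A\<in>B. lie_deriv A (lie_deriv A F) z)" if h: "bounded_linear h" for h :: "complex \<Rightarrow> real"
  proof -
    have "lie_deriv A (lie_deriv A (\<lambda>y. h (F y))) z = h (lie_deriv A (lie_deriv A F) z)" for A
    proof -
      have "lie_deriv A (lie_deriv A (\<lambda>y. h (F y))) z = lie_deriv A (\<lambda>y. h (lie_deriv A F y)) z"
        using W_sub z lie_deriv_compose_linear[OF h smooth_on_has_derivative[OF F]]
        by (intro lie_deriv_cong[OF W_sub(1)]) auto
      then show ?thesis
        using lie_deriv_compose_linear[OF h smooth_on_has_derivative[OF smooth_on_lie_deriv[OF W_sub(1) F]]]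
          W_sub z by auto
    qed
    then show ?thesis
      using riem_div_riem_grad[OF z W_sub smooth_on_compose_linear[OF W_sub(1) h F]] f
      by (simp add: linear_sum[OF bounded_linear.linear[OF h]])
  qed
  show ?thesis
    unfolding tau_def *[OF bounded_linear_Re] *[OF bounded_linear_Im] by (simp add: complex_eq_iff)
qed

lemma kappa_eq:
  assumes z: "z \<in> W" and F: "(F has_derivative F') (at z)" "(G has_derivative G') (at z)"
    and f: "\<And>y. y \<in> W \<Longrightarrow> f y = F y" "\<And>y. y \<in> W \<Longrightarrow> g y = G y"
  shows "kappa GL_metric W f g z = (\<Sum>A\<in>B. F' (z ** A) * G' (z ** A))"
proof -
  have *: "riem_grad GL_metric W (\<lambda>y. h (f y)) z = (\<Sum>A\<in>B. h (F' (z ** A)) *\<^sub>R (z ** A))"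
    if h: "bounded_linear h" and F: "(F has_derivative F') (at z)"
      and f: "\<forall>y\<in>W. f y = F y" for h :: "complex \<Rightarrow> real" and F F' f
    using riem_grad_eq[OF z bounded_linear.has_derivative[OF h F]] f by auto
  have **: "(\<Sum>A\<in>B. r A *\<^sub>R (z ** A)) \<bullet> (\<Sum>A\<in>B. s A *\<^sub>R (z ** A)) = (\<Sum>A\<in>B. r A * s A)" for r s
  proof -
    have "(\<Sum>C\<in>B. r C * (C \<bullet> A)) = r A" if "A \<in> B" for A
      using that finite_B by (simp add: orthonormal if_distrib[of "\<lambda>x. _ * x"] cong: sum.cong if_cong)
    then show ?thesis
      by (simp add: inner_sum_left inner_sum_right inner_unitary_mult[OF unitary[OF z]] mult.commute)
  qed
  have f': "\<forall>y\<in>W. f y = F y" "\<forall>y\<in>W. g y = G y"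
    using f by auto
  note h = *[OF bounded_linear_Re F(1) f'(1)] *[OF bounded_linear_Im F(1) f'(1)]
    *[OF bounded_linear_Re F(2) f'(2)] *[OF bounded_linear_Im F(2) f'(2)]
  show ?thesis
    unfolding kappa_def Let_def h GL_metric_unitary[OF unitary[OF z]] **
    by (simp add: complex_eq_iff sum_subtractf sum.distrib)
qed

end

section \<open>Tangent spaces of the unitary groups\<close>

definition skew_hermitian :: "(complex^'n^'n) set" where
  "skew_hermitian = {A. conj_transpose A = - A}"

definition traceless_skew_hermitian :: "(complex^'n^'n) set" where
  "traceless_skew_hermitian = {A \<in> skew_hermitian. trace A = 0}"

lemma subspace_skew_hermitian: "subspace skew_hermitian"
  by (auto simp: subspace_def skew_hermitian_def linear_0[OF linear_conj_transpose]
      linear_add[OF linear_conj_transpose] linear_cmul[OF linear_conj_transpose])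

lemma linear_trace: "linear (trace :: complex^'n^'n \<Rightarrow> complex)"
  by (auto intro!: linearI simp: trace_def sum.distrib scaleR_sum_right)

lemma subspace_traceless_skew_hermitian: "subspace traceless_skew_hermitian"
  using subspace_skew_hermitian
  by (auto simp: subspace_def traceless_skew_hermitian_def linear_0[OF linear_trace]
      linear_add[OF linear_trace] linear_cmul[OF linear_trace])

lemma unitary_mult:
  assumes "y \<in> unitary_group" "z \<in> unitary_group"
  shows "y ** z \<in> unitary_group"
proof -
  have "conj_transpose (y ** z) ** (y ** z) = mat 1"
    using unitaryD[OF assms(1)] unitaryD[OF assms(2)]
    by (metis conj_transpose_mult matrix_mul_assoc)
  then show ?thesis
    by (simp add: unitary_group_def matrix_left_right_inverse)
qed

lemma det_conj_transpose: "det (conj_transpose A) = cnj (det A)"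
proof -
  have "det (map_matrix cnj (transpose A)) = cnj (det (transpose A))"
    by (simp add: det_def)
  then show ?thesis
    by (simp add: conj_transpose_def)
qed

lemma det_unitary: "z \<in> unitary_group \<Longrightarrow> det z * cnj (det z) = 1"
  by (metis det_I det_conj_transpose det_mul unitaryD(1))

lemma special_unitary_mult:
  "y \<in> special_unitary_group \<Longrightarrow> z \<in> special_unitary_group \<Longrightarrow> y ** z \<in> special_unitary_group"
  by (simp add: special_unitary_group_def unitary_mult det_mul)

text \<open>If A x = x, then x is zero, because the real inner product of A x and x vanishes for
  skew-hermitian A.\<close>

lemma invertible_mat_1_minus_skew:
  fixes A :: "complex^'n^'n"
  assumes "conj_transpose A = - A"
  shows "invertible (mat 1 - A)"
proof -
  have "x = 0" if x: "(mat 1 - A) *v x = 0" for x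
  proof -
    \<comment> \<open>The vector is repeated in all columns to make the inner product identities for
      matrices applicable.\<close>
    define X where "X = (\<chi> i. \<chi> j::'n. x $ i)"
    have "A *v x = x"
      using x by (simp add: matrix_vector_mult_diff_rdistrib)
    then have AX: "A ** X = X"
      by (simp add: X_def vec_eq_iff matrix_matrix_mult_def matrix_vector_mult_def)
    have "(A ** X) \<bullet> X = - ((A ** X) \<bullet> X)"
      by (metis AX assms inner_matrix_mult_left inner_minus_right matrix_mult.minus_left)
    then have "X = 0"
      by (simp add: AX)
    then show ?thesis
      by (simp add: X_def vec_eq_iff)
  qed
  then show ?thesis
    unfolding invertible_left_inverse matrix_left_invertible_ker by blast
qed

text \<open>The curve is the Cayley transform, the product of 1 + tA/2 and the inverse of 1 - tA/2,
  in place of a matrix exponential.\<close>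

lemma unitary_curve:
  fixes A :: "complex^'n^'n"
  assumes A: "A \<in> skew_hermitian"
  obtains c where "\<And>t::real. c t \<in> unitary_group" "c 0 = mat 1"
    "(c has_vector_derivative A) (at 0)"
proof -
  define M N where "M t = mat 1 - (t / 2) *\<^sub>R A" and "N t = mat 1 + (t / 2) *\<^sub>R A" for t :: real
  define J where "J t = matrix_inv (M t)" for t
  have ct: "conj_transpose A = - A"
    using A by (simp add: skew_hermitian_def)
  have inv: "invertible (M t)" for t
    unfolding M_def
    by (rule invertible_mat_1_minus_skew) (simp add: linear_cmul[OF linear_conj_transpose] ct)
  have J: "M t ** J t = mat 1" "J t ** M t = mat 1" for t
  proof -
    obtain B where "M t ** B = mat 1" "B ** M t = mat 1"
      using inv[of t] unfolding invertible_def by blast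
    then show "M t ** J t = mat 1" "J t ** M t = mat 1"
      using matrix_inv_unique[of "M t" B] by (simp_all add: J_def)
  qed
  have M0: "M 0 = mat 1" "N 0 = mat 1"
    by (simp_all add: M_def N_def)
  have J0: "J 0 = mat 1"
    using J(1)[of 0] by (simp add: M0)
  have ctM: "conj_transpose (M t) = N t" "conj_transpose (N t) = M t" for t
    by (simp_all add: M_def N_def linear_cmul[OF linear_conj_transpose] ct
        linear_add[OF linear_conj_transpose] linear_diff[OF linear_conj_transpose])
  have comm: "M t ** N t = N t ** M t" for t
    by (simp add: M_def N_def matrix_mult.diff_left matrix_mult.diff_right matrix_mult.add_left
        matrix_mult.add_right)
  define c where "c t = N t ** J t" for t
  have "c t \<in> unitary_group" for t
  proof -
    have "conj_transpose (c t) ** c t = conj_transpose (J t) ** (M t ** N t) ** J t"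
      by (simp add: c_def conj_transpose_mult ctM matrix_mul_assoc)
    also have "\<dots> = (conj_transpose (J t) ** conj_transpose (M t)) ** (M t ** J t)"
      by (simp add: comm ctM matrix_mul_assoc)
    also have "\<dots> = mat 1"
      by (simp add: J conj_transpose_mult[symmetric])
    finally show ?thesis
      by (simp add: unitary_group_def matrix_left_right_inverse)
  qed
  moreover have "c 0 = mat 1"
    by (simp add: c_def M0 J0)
  moreover have "(c has_vector_derivative A) (at 0)"
  proof -
    have dM: "(M has_derivative (\<lambda>h. - ((h / 2) *\<^sub>R A))) (at 0)"
      and dN: "(N has_derivative (\<lambda>h. (h / 2) *\<^sub>R A)) (at 0)"
      unfolding M_def N_def by (auto intro!: derivative_eq_intros)
    have "M differentiable (at 0)"
      using dM by (auto simp: differentiable_def)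
    then have "J differentiable (at 0)"
      using differentiable_chain_at[of M 0 matrix_inv, OF _ matrix_inv_differentiable[OF inv]]
      by (simp add: J_def[abs_def] o_def)
    then obtain J' where J': "(J has_derivative J') (at 0)"
      by (auto simp: differentiable_def)
    \<comment> \<open>Differentiating \<open>M t ** J t = mat 1\<close> gives the velocity A/2 for
      the inverse. The numerator contributes the other A/2, which explains the halves in
      \<open>M\<close> and \<open>N\<close>.\<close>
    have "((\<lambda>t. M t ** J t) has_derivative (\<lambda>h. M 0 ** J' h + (- ((h / 2) *\<^sub>R A)) ** J 0)) (at 0)"
      by (rule matrix_mult.FDERIV[OF dM J'])
    then have "(\<lambda>h. J' h - (h / 2) *\<^sub>R A) = (\<lambda>h. 0)"
      using has_derivative_unique[OF _ has_derivative_const] by (simp add: J M0 J0)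
    then have J'_eq: "J' h = (h / 2) *\<^sub>R A" for h
      by (metis eq_iff_diff_eq_0)
    have "(c has_derivative (\<lambda>h. N 0 ** J' h + ((h / 2) *\<^sub>R A) ** J 0)) (at 0)"
      unfolding c_def[abs_def] by (rule matrix_mult.FDERIV[OF dN J'])
    moreover have "N 0 ** J' h + ((h / 2) *\<^sub>R A) ** J 0 = h *\<^sub>R A" for h
      by (simp add: M0 J0 J'_eq flip: scaleR_add_left)
    ultimately show ?thesis
      by (simp add: has_vector_derivative_def)
  qed
  ultimately show ?thesis
    by (rule that)
qed

text \<open>A unitary curve is corrected by a diagonal factor that multiplies one row by the
  conjugate of its determinant. The trace of \<open>A\<close> is zero, so this determinant has
  derivative zero at time 0 and the correction leaves the velocity unchanged.\<close>

lemma special_unitary_curve: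
  fixes A :: "complex^'n^'n"
  assumes A: "A \<in> traceless_skew_hermitian"
  obtains c where "\<And>t::real. c t \<in> special_unitary_group" "c 0 = mat 1"
    "(c has_vector_derivative A) (at 0)"
proof -
  obtain c where c: "\<And>t::real. c t \<in> unitary_group" "c 0 = mat 1"
    "(c has_derivative (\<lambda>h. h *\<^sub>R A)) (at 0)"
    using unitary_curve A unfolding traceless_skew_hermitian_def has_vector_derivative_def by blast
  \<comment> \<open>Which row is corrected is immaterial; \<open>undefined\<close> names some
    index.\<close>
  define k :: 'n where "k = undefined"
  define D where "D t = (\<chi> i j. if i = j then if i = k then cnj (det (c t)) else 1 else 0 :: complex^'n^'n)" for t
  have "((\<lambda>t. det (c t)) has_derivative (\<lambda>h. 0)) (at 0)"
    using has_derivative_det_at_mat_1[OF c(3,2)] A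
    by (simp add: linear_cmul[OF linear_trace] traceless_skew_hermitian_def)
  then have d: "((\<lambda>t. cnj (det (c t))) has_derivative (\<lambda>h. 0)) (at 0)"
    using bounded_linear.has_derivative[OF bounded_linear_cnj] by fastforce
  have dD: "(D has_derivative (\<lambda>h. \<chi> i j. 0)) (at 0)"
  proof -
    have "((\<lambda>t. if i = j then if i = k then cnj (det (c t)) else 1 else 0) has_derivative (\<lambda>h. 0)) (at 0)"
      for i j
      using d by (cases "i = j"; cases "i = k") simp_all
    then show ?thesis
      unfolding D_def by (intro has_derivative_vec_lambda)
  qed
  have D0: "D 0 = mat 1"
    unfolding D_def c(2) det_I by (simp add: vec_eq_iff mat_def)
  have "conj_transpose (D t) ** D t = mat 1" for t
    using det_unitary[OF c(1)[of t]]
    by (simp add: D_def vec_eq_iff matrix_matrix_mult_def mat_def if_distrib[of cnj]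
        if_distrib[of "\<lambda>x. x * _"] if_distrib[of "\<lambda>x. _ * x"] cong: if_cong)
  then have "D t \<in> unitary_group" for t
    by (simp add: unitary_group_def matrix_left_right_inverse)
  moreover have "det (D t) = cnj (det (c t))" for t
    by (subst det_diagonal) (auto simp: D_def prod.delta)
  ultimately have su: "D t ** c t \<in> special_unitary_group" for t
    using det_unitary[OF c(1)[of t]]
    by (simp add: special_unitary_group_def unitary_mult c(1) det_mul mult.commute)
  have deriv: "((\<lambda>t. D t ** c t) has_vector_derivative A) (at 0)"
  proof -
    have "((\<chi> i j. 0) :: complex^'n^'n) ** c 0 = 0"
      by (simp add: vec_eq_iff matrix_matrix_mult_def)
    then show ?thesis
      using matrix_mult.FDERIV[OF dD c(3)] by (simp add: has_vector_derivative_def D0)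
  qed
  show ?thesis
    by (rule that[of "\<lambda>t. D t ** c t", OF su _ deriv]) (simp add: D0 c(2))
qed

lemma tangent_space_mono:
  assumes "V \<subseteq> W"
  shows "tangent_space V z \<subseteq> tangent_space W z"
proof
  fix v assume "v \<in> tangent_space V z"
  then obtain \<gamma> where "\<And>t::real. \<gamma> t \<in> V" "\<gamma> 0 = z" "(\<gamma> has_vector_derivative v) (at 0)"
    by (auto simp: tangent_space_def)
  then show "v \<in> tangent_space W z"
    using assms unfolding tangent_space_def by (auto intro!: exI[of _ \<gamma>])
qed

lemma tangent_space_Int_open:
  assumes "open \<Omega>" "z \<in> \<Omega>"
  shows "tangent_space (G \<inter> \<Omega>) z = tangent_space G z"
proof
  show "tangent_space G z \<subseteq> tangent_space (G \<inter> \<Omega>) z"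
  proof
    fix v assume "v \<in> tangent_space G z"
    then obtain \<gamma> where \<gamma>: "\<And>t::real. \<gamma> t \<in> G" "\<gamma> 0 = z" "(\<gamma> has_vector_derivative v) (at 0)"
      by (auto simp: tangent_space_def)
    have "isCont \<gamma> 0"
      using \<gamma>(3) has_vector_derivative_continuous by blast
    then have "eventually (\<lambda>t. \<gamma> t \<in> \<Omega>) (nhds 0)"
      using assms \<gamma>(2) unfolding continuous_at_open eventually_nhds by metis
    then obtain I where I: "open I" "0 \<in> I" "\<And>t. t \<in> I \<Longrightarrow> \<gamma> t \<in> \<Omega>"
      by (auto simp: eventually_nhds)
    \<comment> \<open>\<open>tangent_space\<close> asks for curves that stay in the set at all real
      times, so outside \<open>I\<close> the curve is frozen at \<open>z\<close>.\<close>
    define \<gamma>' where "\<gamma>' t = (if t \<in> I then \<gamma> t else z)" for t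
    have "(\<gamma>' has_vector_derivative v) (at 0)"
      by (rule has_vector_derivative_transform_within_open[OF \<gamma>(3) I(1,2)]) (simp add: \<gamma>'_def)
    moreover have "\<gamma>' t \<in> G \<inter> \<Omega>" for t
      using I(3) \<gamma>(1)[of t] \<gamma>(1)[of 0] \<gamma>(2) assms(2) by (auto simp: \<gamma>'_def)
    moreover have "\<gamma>' 0 = z"
      by (simp add: \<gamma>'_def \<gamma>(2))
    ultimately show "v \<in> tangent_space (G \<inter> \<Omega>) z"
      by (auto simp: tangent_space_def intro!: exI[of _ \<gamma>'])
  qed
qed (simp add: tangent_space_mono)

lemma tangent_space_unitary_subset:
  assumes z: "z \<in> unitary_group" and v: "v \<in> tangent_space unitary_group z"
  shows "conj_transpose z ** v \<in> skew_hermitian"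
proof -
  obtain \<gamma> where \<gamma>: "\<And>t::real. \<gamma> t \<in> unitary_group" "\<gamma> 0 = z"
      "(\<gamma> has_derivative (\<lambda>h. h *\<^sub>R v)) (at 0)"
    using v by (auto simp: tangent_space_def has_vector_derivative_def)
  have "((\<lambda>t. conj_transpose (\<gamma> t) ** \<gamma> t) has_derivative
    (\<lambda>h. conj_transpose (\<gamma> 0) ** (h *\<^sub>R v) + conj_transpose (h *\<^sub>R v) ** \<gamma> 0)) (at 0)"
    by (intro matrix_mult.FDERIV bounded_linear.has_derivative[OF bounded_linear_conj_transpose] \<gamma>(3))
  moreover have "(\<lambda>t. conj_transpose (\<gamma> t) ** \<gamma> t) = (\<lambda>t. mat 1)"
    using unitaryD(2)[OF \<gamma>(1)] by simp
  ultimately have "(\<lambda>h. conj_transpose (\<gamma> 0) ** (h *\<^sub>R v) + conj_transpose (h *\<^sub>R v) ** \<gamma> 0) = (\<lambda>h. 0)"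
    using has_derivative_unique[OF _ has_derivative_const] by fastforce
  from fun_cong[OF this, of 1] have "conj_transpose z ** v + conj_transpose v ** z = 0"
    by (simp add: \<gamma>(2))
  then show ?thesis
    by (simp add: skew_hermitian_def conj_transpose_mult eq_neg_iff_add_eq_0 add.commute)
qed

lemma tangent_space_special_unitary_subset:
  assumes z: "z \<in> special_unitary_group" and v: "v \<in> tangent_space special_unitary_group z"
  shows "conj_transpose z ** v \<in> traceless_skew_hermitian"
proof -
  have zU: "z \<in> unitary_group" and det: "\<And>y. y \<in> special_unitary_group \<Longrightarrow> det y = 1"
    using z by (auto simp: special_unitary_group_def)
  have vU: "v \<in> tangent_space unitary_group z"
    using v tangent_space_mono[of special_unitary_group unitary_group]
    by (auto simp: special_unitary_group_def)
  obtain \<gamma> where \<gamma>: "\<And>t::real. \<gamma> t \<in> special_unitary_group" "\<gamma> 0 = z"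
      "(\<gamma> has_derivative (\<lambda>h. h *\<^sub>R v)) (at 0)"
    using v by (auto simp: tangent_space_def has_vector_derivative_def)
  \<comment> \<open>Translation to the identity makes the derivative of the determinant a
    trace.\<close>
  have "((\<lambda>t. det (conj_transpose z ** \<gamma> t)) has_derivative
      (\<lambda>h. trace (conj_transpose z ** (h *\<^sub>R v)))) (at 0)"
    using unitaryD(2)[OF zU] \<gamma>(2)
    by (intro has_derivative_det_at_mat_1 bounded_linear.has_derivative[OF matrix_mult.bounded_linear_right]
        \<gamma>(3)) auto
  moreover have "(\<lambda>t. det (conj_transpose z ** \<gamma> t)) = (\<lambda>t. det (conj_transpose z))"
    using det[OF \<gamma>(1)] by (simp add: det_mul)
  ultimately have "(\<lambda>h. trace (conj_transpose z ** (h *\<^sub>R v))) = (\<lambda>h. 0)"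
    using has_derivative_unique[OF _ has_derivative_const] by fastforce
  from fun_cong[OF this, of 1] have "trace (conj_transpose z ** v) = 0"
    by simp
  then show ?thesis
    using tangent_space_unitary_subset[OF zU vU] by (simp add: traceless_skew_hermitian_def)
qed

lemma tangent_space_translate:
  assumes curve: "\<And>A. A \<in> S \<Longrightarrow> \<exists>c. (\<forall>t::real. c t \<in> G) \<and> c 0 = mat 1 \<and> (c has_vector_derivative A) (at 0)"
    and mult: "\<And>y z. y \<in> G \<Longrightarrow> z \<in> G \<Longrightarrow> y ** z \<in> G"
    and sub: "\<And>z v. z \<in> G \<Longrightarrow> v \<in> tangent_space G z \<Longrightarrow> conj_transpose z ** v \<in> S"
    and "z \<in> G" "G \<subseteq> unitary_group"
  shows "tangent_space G z = (\<lambda>A. z ** A) ` S"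
proof
  show "tangent_space G z \<subseteq> (\<lambda>A. z ** A) ` S"
  proof
    fix v assume "v \<in> tangent_space G z"
    then show "v \<in> (\<lambda>A. z ** A) ` S"
      using sub[OF \<open>z \<in> G\<close>] unitaryD(4)[of z v] assms(4,5) by (intro image_eqI) auto
  qed
  show "(\<lambda>A. z ** A) ` S \<subseteq> tangent_space G z"
  proof
    fix v assume "v \<in> (\<lambda>A. z ** A) ` S"
    then obtain A where A: "A \<in> S" "v = z ** A" by auto
    from curve[OF A(1)] obtain c where c: "\<And>t::real. c t \<in> G" "c 0 = mat 1"
      "(c has_vector_derivative A) (at 0)" by blast
    have "((\<lambda>t. z ** c t) has_vector_derivative v) (at 0)"
      unfolding A(2)
      by (rule bounded_linear.has_vector_derivative[OF matrix_mult.bounded_linear_right c(3)])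
    then show "v \<in> tangent_space G z"
      unfolding tangent_space_def using mult[OF \<open>z \<in> G\<close> c(1)] c(2)
      by (auto intro!: exI[of _ "\<lambda>t. z ** c t"])
  qed
qed

lemma tangent_space_unitary:
  assumes "z \<in> unitary_group"
  shows "tangent_space unitary_group z = (\<lambda>A. z ** A) ` skew_hermitian"
proof (rule tangent_space_translate[OF _ unitary_mult tangent_space_unitary_subset assms order_refl])
  show "\<exists>c. (\<forall>t::real. c t \<in> unitary_group) \<and> c 0 = mat 1 \<and> (c has_vector_derivative A) (at 0)"
    if "A \<in> skew_hermitian" for A :: "complex^'n^'n"
    by (rule unitary_curve[OF that]) (intro exI conjI allI)
qed

lemma tangent_space_special_unitary:
  assumes "z \<in> special_unitary_group"
  shows "tangent_space special_unitary_group z = (\<lambda>A. z ** A) ` traceless_skew_hermitian"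
proof (rule tangent_space_translate[OF _ special_unitary_mult tangent_space_special_unitary_subset assms])
  show "\<exists>c. (\<forall>t::real. c t \<in> special_unitary_group) \<and> c 0 = mat 1 \<and>
      (c has_vector_derivative A) (at 0)" if "A \<in> traceless_skew_hermitian" for A :: "complex^'n^'n"
    by (rule special_unitary_curve[OF that]) (intro exI conjI allI)
  show "special_unitary_group \<subseteq> unitary_group"
    by (auto simp: special_unitary_group_def)
qed

lemma orthonormal_basis_exists:
  fixes S :: "'a::euclidean_space set"
  assumes "subspace S"
  obtains B where "span B = S" "\<And>e e'. e \<in> B \<Longrightarrow> e' \<in> B \<Longrightarrow> e \<bullet> e' = (if e = e' then 1 else 0)"
proof -
  obtain B where B: "pairwise orthogonal B" "\<And>x. x \<in> B \<Longrightarrow> norm x = 1" "span B = S"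
    using orthonormal_basis_subspace[OF assms] by metis
  have "e \<bullet> e' = (if e = e' then 1 else 0)" if "e \<in> B" "e' \<in> B" for e e'
    using B(1) B(2)[OF that(1)] that by (auto simp: norm_eq_1 pairwise_def orthogonal_def)
  with B(3) that show thesis by blast
qed

lemma left_translated_unitary:
  assumes "span B = skew_hermitian"
    "\<And>A C. A \<in> B \<Longrightarrow> C \<in> B \<Longrightarrow> A \<bullet> C = (if A = C then 1 else 0)"
  shows "left_translated unitary_group skew_hermitian B"
  using assms by unfold_locales (auto simp: tangent_space_unitary, simp add: skew_hermitian_def)

lemma left_translated_special_unitary:
  assumes "open \<Omega>" "span B = traceless_skew_hermitian"
    "\<And>A C. A \<in> B \<Longrightarrow> C \<in> B \<Longrightarrow> A \<bullet> C = (if A = C then 1 else 0)"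
  shows "left_translated (special_unitary_group \<inter> \<Omega>) traceless_skew_hermitian B"
proof
  show "special_unitary_group \<inter> \<Omega> \<subseteq> unitary_group"
    by (auto simp: special_unitary_group_def)
  show "tangent_space (special_unitary_group \<inter> \<Omega>) z = (\<lambda>A. z ** A) ` traceless_skew_hermitian"
    if "z \<in> special_unitary_group \<inter> \<Omega>" for z
    using that by (simp add: tangent_space_Int_open[OF assms(1)] tangent_space_special_unitary)
  show "conj_transpose A = - A" if "A \<in> traceless_skew_hermitian" for A
    using that by (simp add: traceless_skew_hermitian_def skew_hermitian_def)
qed (fact assms)+

lemma mat_mult_component: "(mat s ** A) $ i $ j = s * A $ i $ j" for A :: "complex^'n^'n"
  by (simp add: matrix_matrix_mult_def mat_def if_distrib[of "\<lambda>x. x * _"] cong: if_cong)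

text \<open>Dividing by an n-th root of the determinant lands in SU(n). A nonzero value of a
  homogeneous polynomial on U(n) is thereby carried over to SU(n).\<close>

lemma unitary_phase:
  fixes z :: "complex^'n^'n"
  assumes "z \<in> unitary_group"
  obtains s where "s \<noteq> 0" "mat s ** z \<in> special_unitary_group"
proof -
  let ?n = "CARD('n)"
  define s where "s = exp (- Ln (det z) / of_nat ?n)"
  have nz: "det z \<noteq> 0"
    using det_unitary[OF assms] by auto
  have "s ^ ?n = exp (of_nat ?n * (- Ln (det z) / of_nat ?n))"
    by (simp only: s_def exp_of_nat_mult)
  then have sn: "s ^ ?n * det z = 1"
    using nz by (simp add: exp_minus)
  have "norm (det z) ^ 2 = 1"
    using arg_cong[OF det_unitary[OF assms], of norm] by (simp add: norm_mult power2_eq_square)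
  then have "norm (det z) = 1"
    using power_eq_1_iff[of "norm (det z)" 2] by simp
  with arg_cong[OF sn, of norm] have "norm s ^ ?n = 1"
    by (simp add: norm_mult norm_power)
  then have "norm s = 1"
    using power_eq_1_iff[of "norm s" ?n] by simp
  then have "s * cnj s = 1"
    by (simp add: complex_norm_square[symmetric])
  then have "conj_transpose (mat s) ** mat s = (mat 1 :: complex^'n^'n)"
    by (simp add: vec_eq_iff mat_mult_component) (simp add: mat_def mult.commute)
  then have "(mat s :: complex^'n^'n) \<in> unitary_group"
    by (simp add: unitary_group_def matrix_left_right_inverse)
  moreover have "det (mat s :: complex^'n^'n) = s ^ ?n"
    by (subst det_diagonal) (auto simp: mat_def)
  ultimately have "mat s ** z \<in> special_unitary_group"
    using assms sn by (simp add: special_unitary_group_def unitary_mult det_mul)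
  moreover have "s \<noteq> 0"
    by (simp add: s_def)
  ultimately show thesis
    by (rule that[rotated])
qed

section \<open>Casimir identities\<close>

lemma trace_conj_transpose: "trace (conj_transpose A) = cnj (trace A)"
  by (simp add: trace_def)

lemma trace_mat_mult: "trace (mat s ** A) = s * trace A" for A :: "complex^'n^'n"
  by (simp add: trace_def mat_mult_component sum_distrib_left)

text \<open>For \<open>N\<close> in the real span, \<open>trace (N ** A)\<close> is real and equals
  minus the inner product, so the sum is an orthonormal expansion up to sign. Complex linearity in
  \<open>M\<close> extends this to the complexified span.\<close>

lemma complexified_skew_expand:
  fixes B :: "(complex^'n^'n) set"
  assumes orth: "\<And>A C. A \<in> B \<Longrightarrow> C \<in> B \<Longrightarrow> A \<bullet> C = (if A = C then 1 else 0)"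
    and skew: "span B \<subseteq> skew_hermitian"
    and M: "M1 \<in> span B" "M2 \<in> span B" "M = M1 + mat \<i> ** M2"
  shows "(\<Sum>A\<in>B. trace (M ** A) * A $ k $ l) = - M $ k $ l"
proof -
  have *: "(\<Sum>A\<in>B. trace (N ** A) * A $ k $ l) = - N $ k $ l" if N: "N \<in> span B" for N
  proof -
    have "trace (N ** A) = - of_real (N \<bullet> A)" if "A \<in> B" for A
    proof -
      have ct: "conj_transpose N = - N" "conj_transpose A = - A"
        using skew N span_base[OF that] by (auto simp: skew_hermitian_def)
      have "cnj (trace (N ** A)) = trace (N ** A)"
        by (simp add: trace_conj_transpose[symmetric] conj_transpose_mult ct trace_mul_sym[of A]
            matrix_mult.minus_left matrix_mult.minus_right)
      then have "trace (N ** A) = of_real (Re (trace (N ** A)))"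
        by (simp add: complex_eq_iff)
      also have "Re (trace (N ** A)) = - (N \<bullet> A)"
        by (simp add: inner_matrix ct matrix_mult.minus_right linear_neg[OF linear_trace])
      finally show ?thesis by simp
    qed
    then have "(\<Sum>A\<in>B. trace (N ** A) * A $ k $ l) = - (\<Sum>A\<in>B. (N \<bullet> A) *\<^sub>R A) $ k $ l"
      by (simp add: sum_negf scaleR_conv_of_real[where 'a = complex])
    also have "(\<Sum>A\<in>B. (N \<bullet> A) *\<^sub>R A) = N"
      using orth N by (rule orthonormal_finite_expand(2))
    finally show ?thesis .
  qed
  have "trace (M ** A) = trace (M1 ** A) + \<i> * trace (M2 ** A)" for A
    by (simp add: M(3) matrix_mult.add_left trace_add trace_mat_mult flip: matrix_mul_assoc)
  then have "(\<Sum>A\<in>B. trace (M ** A) * A $ k $ l) =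
      (\<Sum>A\<in>B. trace (M1 ** A) * A $ k $ l) + \<i> * (\<Sum>A\<in>B. trace (M2 ** A) * A $ k $ l)"
    by (simp add: sum.distrib sum_distrib_left distrib_right mult.assoc)
  then show ?thesis
    by (simp add: *[OF M(1)] *[OF M(2)] M(3) mat_mult_component)
qed

text \<open>The hypotheses \<open>casimir c B\<close> below record the only property of the Lie algebra that enters
  the computations: \<open>c = 0\<close> for \<open>\<uu>(n)\<close> and \<open>c = 1/n\<close> for \<open>\<ss>\<uu>(n)\<close>.\<close>

definition casimir :: "complex \<Rightarrow> (complex^'n^'n) set \<Rightarrow> bool" where
  "casimir c B \<longleftrightarrow> (\<forall>i j k l. (\<Sum>A\<in>B. A $ i $ j * A $ k $ l) =
     c * (if i = j \<and> k = l then 1 else 0) - (if i = l \<and> j = k then 1 else 0))"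

text \<open>The complexification of u(n) consists of all matrices, that of su(n) of the traceless
  ones.\<close>

lemma cartesian_decomposition:
  fixes M :: "complex^'n^'n"
  defines "M1 \<equiv> (1/2) *\<^sub>R (M - conj_transpose M)" and "M2 \<equiv> mat (- \<i> / 2) ** (M + conj_transpose M)"
  shows "M = M1 + mat \<i> ** M2" "M1 \<in> skew_hermitian" "M2 \<in> skew_hermitian"
    "trace M = 0 \<Longrightarrow> trace M1 = 0" "trace M = 0 \<Longrightarrow> trace M2 = 0"
proof -
  have "mat \<i> ** (mat (- \<i> / 2) ** X) = (1/2) *\<^sub>R X" for X :: "complex^'n^'n"
    by (simp add: vec_eq_iff mat_mult_component) (simp add: scaleR_conv_of_real[where 'a = complex])
  then show "M = M1 + mat \<i> ** M2"
    by (simp add: M1_def M2_def vec_eq_iff) (simp add: scaleR_conv_of_real[where 'a = complex] field_simps)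
  show "M1 \<in> skew_hermitian" "M2 \<in> skew_hermitian"
    by (simp_all add: M1_def M2_def skew_hermitian_def vec_eq_iff mat_mult_component algebra_simps
        scaleR_conv_of_real[where 'a = complex])
  show "trace M = 0 \<Longrightarrow> trace M1 = 0" "trace M = 0 \<Longrightarrow> trace M2 = 0"
    by (simp_all add: M1_def M2_def linear_cmul[OF linear_trace] trace_sub trace_add trace_mat_mult
        trace_conj_transpose)
qed

definition matrix_unit :: "'n \<Rightarrow> 'n \<Rightarrow> complex^'n^'n" where
  "matrix_unit i j = (\<chi> k l. if k = i \<and> l = j then 1 else 0)"

lemma trace_matrix_unit_mult: "trace (matrix_unit j i ** A) = A $ i $ j"
proof -
  have "(matrix_unit j i ** A) $ k $ k = (if k = j then A $ i $ j else 0)" for k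
    by (cases "k = j") (simp_all add: matrix_unit_def matrix_matrix_mult_def
        if_distrib[of "\<lambda>x. x * _"] cong: if_cong)
  then show ?thesis
    by (simp add: trace_def)
qed

lemma trace_matrix_unit: "trace (matrix_unit j i) = (if i = j then 1 else 0)"
  by (auto simp: trace_def matrix_unit_def intro!: sum.neutral)

text \<open>Pairing \<open>A\<close> with a matrix unit under the trace extracts a single entry of
  \<open>A\<close>, so the expansion of matrix units is the Casimir identity.\<close>

lemma casimir_unitary:
  fixes B :: "(complex^'n^'n) set"
  assumes "\<And>A C. A \<in> B \<Longrightarrow> C \<in> B \<Longrightarrow> A \<bullet> C = (if A = C then 1 else 0)"
    and "span B = skew_hermitian"
  shows "casimir 0 B"
  unfolding casimir_def
proof (intro allI)
  fix i j k l :: 'n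
  let ?M = "matrix_unit j i"
  have "(\<Sum>A\<in>B. trace (?M ** A) * A $ k $ l) = - ?M $ k $ l"
    by (rule complexified_skew_expand[OF assms(1)])
      (use assms(2) cartesian_decomposition[of ?M] in auto)
  then show "(\<Sum>A\<in>B. A $ i $ j * A $ k $ l) =
      0 * (if i = j \<and> k = l then 1 else 0) - (if i = l \<and> j = k then 1 else 0)"
    unfolding trace_matrix_unit_mult by (auto simp: matrix_unit_def)
qed

lemma casimir_special_unitary:
  fixes B :: "(complex^'n^'n) set"
  assumes "\<And>A C. A \<in> B \<Longrightarrow> C \<in> B \<Longrightarrow> A \<bullet> C = (if A = C then 1 else 0)"
    and "span B = traceless_skew_hermitian"
  shows "casimir (1 / of_nat CARD('n)) B"
  unfolding casimir_def
proof (intro allI)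
  fix i j k l :: 'n
  \<comment> \<open>The matrix unit is made traceless in order to lie in the complexification of
    su(n). The correction keeps its trace pairing with traceless \<open>A\<close> and produces the
    constant 1/n.\<close>
  let ?s = "trace (matrix_unit j i) / of_nat CARD('n)"
  let ?M = "matrix_unit j i - mat ?s ** mat 1"
  have "trace ?M = 0"
    by (simp add: trace_sub trace_mat_mult trace_I del: matrix_mul_rid)
  then have "(\<Sum>A\<in>B. trace (?M ** A) * A $ k $ l) = - ?M $ k $ l"
    by (intro complexified_skew_expand[OF assms(1)])
      (use assms(2) cartesian_decomposition[of ?M] in \<open>auto simp: traceless_skew_hermitian_def\<close>)
  moreover have "trace (?M ** A) = A $ i $ j" if "A \<in> B" for A
  proof -
    have "trace A = 0"
      using that assms(2) span_base by (auto simp: traceless_skew_hermitian_def)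
    then show ?thesis
      by (simp add: matrix_mult.diff_left trace_sub trace_mat_mult trace_matrix_unit_mult)
  qed
  ultimately have "(\<Sum>A\<in>B. A $ i $ j * A $ k $ l) = - ?M $ k $ l"
    by simp
  also have "\<dots> = 1 / of_nat CARD('n) * (if i = j \<and> k = l then 1 else 0) -
      (if i = l \<and> j = k then 1 else 0)"
    unfolding vector_minus_component mat_mult_component trace_matrix_unit
    unfolding matrix_unit_def mat_def vec_lambda_beta
    by (cases "i = j"; cases "k = l"; cases "i = l"; cases "j = k"; simp)
  finally show "(\<Sum>A\<in>B. A $ i $ j * A $ k $ l) = 1 / of_nat CARD('n) *
      (if i = j \<and> k = l then 1 else 0) - (if i = l \<and> j = k then 1 else 0)" .
qed

section \<open>Matrix coefficients as bilinear forms in a row vector and a column vector\<close>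

definition matform :: "complex^'n \<Rightarrow> complex^'n \<Rightarrow> complex^'n^'n \<Rightarrow> complex" where
  "matform x y z = (\<Sum>i\<in>UNIV. \<Sum>j\<in>UNIV. x $ i * y $ j * z $ i $ j)"

lemma linear_matform: "linear (matform x y)"
  by (auto intro!: linearI simp: matform_def distrib_left sum.distrib scaleR_sum_right)

lemmas bounded_linear_matform = linear_matform[unfolded linear_conv_bounded_linear]

text \<open>Absorbing \<open>z\<close> into the row vector leaves a form in \<open>A\<close> alone,
  to which the Casimir identity applies.\<close>

lemma matform_mult: "matform x y (z ** A) = matform (x v* z) y A"
proof -
  have "matform x y (z ** A) = (\<Sum>i\<in>UNIV. \<Sum>j\<in>UNIV. \<Sum>k\<in>UNIV. x $ i * y $ j * (z $ i $ k * A $ k $ j))"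
    by (simp add: matform_def matrix_matrix_mult_def sum_distrib_left)
  also have "\<dots> = (\<Sum>i\<in>UNIV. \<Sum>k\<in>UNIV. \<Sum>j\<in>UNIV. x $ i * y $ j * (z $ i $ k * A $ k $ j))"
    by (intro sum.cong refl sum.swap)
  also have "\<dots> = (\<Sum>k\<in>UNIV. \<Sum>i\<in>UNIV. \<Sum>j\<in>UNIV. x $ i * y $ j * (z $ i $ k * A $ k $ j))"
    by (rule sum.swap)
  also have "\<dots> = (\<Sum>k\<in>UNIV. \<Sum>j\<in>UNIV. \<Sum>i\<in>UNIV. x $ i * y $ j * (z $ i $ k * A $ k $ j))"
    by (intro sum.cong refl sum.swap)
  also have "\<dots> = matform (x v* z) y A"
    by (simp add: matform_def vector_matrix_mult_def sum_distrib_right sum_distrib_left mult_ac)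
  finally show ?thesis .
qed

lemma matform_mat_1: "matform x y (mat 1) = (\<Sum>i\<in>UNIV. x $ i * y $ i)"
  by (simp add: matform_def mat_def if_distrib[of "\<lambda>x. _ * x"] cong: if_cong)

text \<open>The first Kronecker term of the Casimir identity reproduces the product of the two
  forms. The second pairs each row vector with the column vector of the other form; this exchange is
  the origin of R and S.\<close>

lemma casimir_sum_matform:
  fixes B :: "(complex^'n^'n) set"
  assumes "casimir c B"
  shows "(\<Sum>A\<in>B. matform x y (z ** A) * matform x' y' (z ** A)) =
    c * matform x y z * matform x' y' z - matform x y' z * matform x' y z"
proof -
  let ?u = "x v* z" and ?w = "x' v* z"
  have cas: "(\<Sum>A\<in>B. A $ i $ j * A $ k $ l) =
      c * (if i = j \<and> k = l then 1 else 0) - (if i = l \<and> j = k then 1 else 0)" for i j k l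
    using assms unfolding casimir_def by blast
  have "(\<Sum>A\<in>B. matform x y (z ** A) * matform x' y' (z ** A)) =
      (\<Sum>A\<in>B. \<Sum>i\<in>UNIV. \<Sum>j\<in>UNIV. \<Sum>k\<in>UNIV. \<Sum>l\<in>UNIV.
        ?u $ i * y $ j * (?w $ k * y' $ l) * (A $ i $ j * A $ k $ l))"
    unfolding matform_mult unfolding matform_def sum_distrib_right
    unfolding sum_distrib_left by (intro sum.cong refl) (simp add: mult_ac)
  also have "\<dots> = (\<Sum>i\<in>UNIV. \<Sum>j\<in>UNIV. \<Sum>k\<in>UNIV. \<Sum>l\<in>UNIV.
        ?u $ i * y $ j * (?w $ k * y' $ l) * (\<Sum>A\<in>B. A $ i $ j * A $ k $ l))"
    unfolding sum_distrib_left by (simp only: sum.swap[of _ UNIV B])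
  also have "\<dots> = (\<Sum>i\<in>UNIV. \<Sum>j\<in>UNIV. \<Sum>k\<in>UNIV. \<Sum>l\<in>UNIV.
        (if i = j \<and> k = l then c * (?u $ i * y $ j * (?w $ k * y' $ l)) else 0)) -
      (\<Sum>i\<in>UNIV. \<Sum>j\<in>UNIV. \<Sum>k\<in>UNIV. \<Sum>l\<in>UNIV.
        (if i = l \<and> j = k then ?u $ i * y $ j * (?w $ k * y' $ l) else 0))"
    by (simp only: cas right_diff_distrib sum_subtractf)
      (simp only: if_distrib[of "\<lambda>x. _ * x"] mult_zero_right mult_1_right, simp only: mult_ac)
  also have "\<dots> = c * (\<Sum>i\<in>UNIV. \<Sum>k\<in>UNIV. ?u $ i * y $ i * (?w $ k * y' $ k)) -
      (\<Sum>i\<in>UNIV. \<Sum>j\<in>UNIV. ?u $ i * y $ j * (?w $ j * y' $ i))"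
  proof -
    have e1: "(\<Sum>j\<in>UNIV. \<Sum>k\<in>UNIV. \<Sum>l\<in>UNIV. if i = j \<and> k = l then F j k l else 0) =
        (\<Sum>k\<in>UNIV. F i k k)" for i :: 'n and F :: "'n \<Rightarrow> 'n \<Rightarrow> 'n \<Rightarrow> complex"
    proof -
      have "(\<Sum>k\<in>UNIV. \<Sum>l\<in>UNIV. if i = j \<and> k = l then F j k l else 0) =
          (if i = j then \<Sum>k\<in>UNIV. F j k k else 0)" for j
        by (cases "i = j") simp_all
      then show ?thesis by simp
    qed
    have e2: "(\<Sum>j\<in>UNIV. \<Sum>k\<in>UNIV. \<Sum>l\<in>UNIV. if i = l \<and> j = k then F j k l else 0) =
        (\<Sum>j\<in>UNIV. F j j i)" for i :: 'n and F :: "'n \<Rightarrow> 'n \<Rightarrow> 'n \<Rightarrow> complex"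
    proof -
      have "(\<Sum>l\<in>UNIV. if i = l \<and> j = k then F j k l else 0) =
          (if j = k then F j k i else 0)" for j k
        by (cases "j = k") simp_all
      then show ?thesis by simp
    qed
    show ?thesis
      by (simp only: sum_distrib_left e1 e2)
  qed
  also have "\<dots> = c * matform x y z * matform x' y' z - matform x y' z * matform x' y z"
  proof -
    have "matform v w z = (\<Sum>i\<in>UNIV. (v v* z) $ i * w $ i)" for v w
      using matform_mult[of v w z "mat 1"] by (simp add: matform_mat_1)
    then show ?thesis
      by (simp add: sum_product mult_ac) (rule sum.swap)
  qed
  finally show ?thesis .
qed

text \<open>Contracting the inner indices of the Casimir identity shows that the squares of the
  basis add up to a scalar matrix: \<open>c\<close> arises for one value of the index, and -1 for
  each of its n values.\<close>

lemma casimir_sum_square: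
  fixes B :: "(complex^'n^'n) set"
  assumes "casimir c B"
  shows "(\<Sum>A\<in>B. matform x y (z ** A ** A)) = (c - of_nat CARD('n)) * matform x y z"
proof -
  have "(\<Sum>A\<in>B. A ** A) $ i $ l = (mat (c - of_nat CARD('n)) ** mat 1) $ i $ l" for i l
  proof -
    have "(\<Sum>A\<in>B. A ** A) $ i $ l = (\<Sum>j\<in>UNIV. \<Sum>A\<in>B. A $ i $ j * A $ j $ l)"
      by (simp add: matrix_matrix_mult_def sum.swap[of _ B])
    also have "\<dots> = (\<Sum>j\<in>UNIV. (if j = i then if i = l then c else 0 else 0)
        - (if i = l then 1 else 0))"
      using assms unfolding casimir_def by (intro sum.cong refl) auto
    also have "\<dots> = (mat (c - of_nat CARD('n)) ** mat 1) $ i $ l"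
      unfolding mat_mult_component by (auto simp: sum_subtractf mat_def)
    finally show ?thesis .
  qed
  then have *: "(\<Sum>A\<in>B. A ** A) = mat (c - of_nat CARD('n)) ** mat 1"
    by (simp add: vec_eq_iff)
  have "(\<Sum>A\<in>B. matform x y (z ** A ** A)) = matform x y (z ** (\<Sum>A\<in>B. A ** A))"
    by (simp add: matrix_mult.sum_right linear_sum[OF linear_matform] matrix_mul_assoc)
  also have "\<dots> = matform (x v* z) y (mat (c - of_nat CARD('n)) ** mat 1)"
    by (simp add: * matform_mult)
  also have "\<dots> = (c - of_nat CARD('n)) * matform (x v* z) y (mat 1)"
    by (simp add: matform_def mat_mult_component sum_distrib_left mult_ac del: matrix_mul_rid)
  also have "matform (x v* z) y (mat 1) = matform x y z"
    by (simp add: matform_mult[symmetric])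
  finally show ?thesis .
qed

section \<open>The Laplacian as a sum of squares of Lie derivatives\<close>

text \<open>Ambient counterparts of \<open>tau\<close> and \<open>kappa\<close>, free of any
  submanifold, for which the Leibniz rules can be stated on open sets.\<close>

definition laplace :: "(complex^'n^'n) set \<Rightarrow> (complex^'n^'n \<Rightarrow> complex) \<Rightarrow> complex^'n^'n \<Rightarrow> complex" where
  "laplace B F z = (\<Sum>A\<in>B. lie_deriv A (lie_deriv A F) z)"

definition gradient_form :: "(complex^'n^'n) set \<Rightarrow> (complex^'n^'n \<Rightarrow> complex) \<Rightarrow>
    (complex^'n^'n \<Rightarrow> complex) \<Rightarrow> complex^'n^'n \<Rightarrow> complex" where
  "gradient_form B F G z = (\<Sum>A\<in>B. lie_deriv A F z * lie_deriv A G z)"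

lemma gradient_form_commute: "gradient_form B F G z = gradient_form B G F z"
  by (simp add: gradient_form_def mult.commute)

lemma matform_has_derivative: "(matform x y has_derivative matform x y) (at z)"
  by (rule bounded_linear_imp_has_derivative[OF bounded_linear_matform])

lemma lie_deriv_matform: "lie_deriv A (matform x y) z = matform x y (z ** A)"
  by (rule lie_deriv_eqI[OF matform_has_derivative])

lemma lie_deriv_lie_deriv_matform:
  "lie_deriv A (lie_deriv A (matform x y)) z = matform x y (z ** A ** A)"
proof -
  have "lie_deriv A (matform x y) = (\<lambda>z. matform x y (z ** A))"
    by (simp add: fun_eq_iff lie_deriv_matform)
  then show ?thesis
    using lie_deriv_eqI[OF bounded_linear.has_derivative[OF bounded_linear_matform
        bounded_linear_imp_has_derivative[OF matrix_mult.bounded_linear_left]]] by simp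
qed

lemma gradient_form_matform:
  "casimir c B \<Longrightarrow> gradient_form B (matform x y) (matform x' y') z =
    c * matform x y z * matform x' y' z - matform x y' z * matform x' y z"
  by (simp add: gradient_form_def lie_deriv_matform casimir_sum_matform)

lemma laplace_matform:
  "casimir c B \<Longrightarrow> laplace B (matform x y) z = (c - of_nat CARD('n)) * matform x y z"
  for B :: "(complex^'n^'n) set"
  by (simp add: laplace_def lie_deriv_lie_deriv_matform casimir_sum_square)

locale lie_calculus =
  fixes \<Omega> B :: "(complex^'n^'n) set"
  assumes open_dom: "open \<Omega>"
begin

lemmas has_deriv = smooth_on_has_derivative[where S = \<Omega>]

lemma lie_deriv_add:
  assumes "smooth_on \<Omega> F" "smooth_on \<Omega> G" "z \<in> \<Omega>"
  shows "lie_deriv A (\<lambda>z. F z + G z) z = lie_deriv A F z + lie_deriv A G z"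
  using lie_deriv_eqI[OF has_derivative_add[OF has_deriv[OF assms(1,3)] has_deriv[OF assms(2,3)]], of A]
  by (simp only: lie_deriv_def)

lemma lie_deriv_mult:
  fixes F G :: "complex^'n^'n \<Rightarrow> complex"
  assumes "smooth_on \<Omega> F" "smooth_on \<Omega> G" "z \<in> \<Omega>"
  shows "lie_deriv A (\<lambda>z. F z * G z) z = F z * lie_deriv A G z + lie_deriv A F z * G z"
  using lie_deriv_eqI[OF has_derivative_mult[OF has_deriv[OF assms(1,3)] has_deriv[OF assms(2,3)]], of A]
  by (simp only: lie_deriv_def)

lemma lie_deriv_cmult:
  fixes F :: "complex^'n^'n \<Rightarrow> complex"
  assumes "smooth_on \<Omega> F" "z \<in> \<Omega>"
  shows "lie_deriv A (\<lambda>z. c * F z) z = c * lie_deriv A F z"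
  using lie_deriv_eqI[OF has_derivative_mult_right[OF has_deriv[OF assms]], of A]
  by (simp only: lie_deriv_def)

lemma lie_deriv_inverse:
  fixes F :: "complex^'n^'n \<Rightarrow> complex"
  assumes "smooth_on \<Omega> F" "z \<in> \<Omega>" "F z \<noteq> 0"
  shows "lie_deriv A (\<lambda>z. inverse (F z)) z = - (inverse (F z) * lie_deriv A F z * inverse (F z))"
  using lie_deriv_eqI[OF Deriv.has_derivative_inverse[OF assms(3) has_deriv[OF assms(1,2)]], of A]
  by (simp only: lie_deriv_def)

lemma smooth_lie_deriv: "smooth_on \<Omega> F \<Longrightarrow> smooth_on \<Omega> (lie_deriv A F)"
  by (rule smooth_on_lie_deriv[OF open_dom])

lemma gradient_form_mult_right:
  assumes "smooth_on \<Omega> F" "smooth_on \<Omega> G" "z \<in> \<Omega>"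
  shows "gradient_form B H (\<lambda>z. F z * G z) z = F z * gradient_form B H G z + G z * gradient_form B H F z"
  by (simp add: gradient_form_def lie_deriv_mult[OF assms] sum_distrib_left algebra_simps sum.distrib)

lemma gradient_form_add_right:
  assumes "smooth_on \<Omega> F" "smooth_on \<Omega> G" "z \<in> \<Omega>"
  shows "gradient_form B H (\<lambda>z. F z + G z) z = gradient_form B H F z + gradient_form B H G z"
  by (simp add: gradient_form_def lie_deriv_add[OF assms] algebra_simps sum.distrib)

lemma gradient_form_cmult_right:
  assumes "smooth_on \<Omega> F" "z \<in> \<Omega>"
  shows "gradient_form B H (\<lambda>z. c * F z) z = c * gradient_form B H F z"
  by (simp add: gradient_form_def lie_deriv_cmult[OF assms] sum_distrib_left algebra_simps)

lemma gradient_form_inverse_right: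
  assumes "smooth_on \<Omega> F" "z \<in> \<Omega>" "F z \<noteq> 0"
  shows "gradient_form B H (\<lambda>z. inverse (F z)) z = - (gradient_form B H F z * inverse (F z) ^ 2)"
  by (simp add: gradient_form_def lie_deriv_inverse[OF assms] sum_distrib_left sum_distrib_right
      sum_negf power2_eq_square mult_ac)

lemma laplace_add:
  assumes "smooth_on \<Omega> F" "smooth_on \<Omega> G" "z \<in> \<Omega>"
  shows "laplace B (\<lambda>z. F z + G z) z = laplace B F z + laplace B G z"
proof -
  have "lie_deriv A (lie_deriv A (\<lambda>z. F z + G z)) z =
      lie_deriv A (\<lambda>z. lie_deriv A F z + lie_deriv A G z) z" for A
    by (rule lie_deriv_cong[OF open_dom assms(3)]) (rule lie_deriv_add[OF assms(1,2)])
  then show ?thesis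
    by (simp add: laplace_def lie_deriv_add[OF smooth_lie_deriv smooth_lie_deriv] assms sum.distrib)
qed

lemma laplace_cmult:
  assumes "smooth_on \<Omega> F" "z \<in> \<Omega>"
  shows "laplace B (\<lambda>z. c * F z) z = c * laplace B F z"
proof -
  have "lie_deriv A (lie_deriv A (\<lambda>z. c * F z)) z = lie_deriv A (\<lambda>z. c * lie_deriv A F z) z" for A
    by (rule lie_deriv_cong[OF open_dom assms(2)]) (rule lie_deriv_cmult[OF assms(1)])
  then show ?thesis
    by (simp add: laplace_def lie_deriv_cmult[OF smooth_lie_deriv] assms sum_distrib_left)
qed

lemma laplace_const:
  assumes "z \<in> \<Omega>"
  shows "laplace B (\<lambda>z. c) z = 0"
proof -
  have "lie_deriv A (\<lambda>z. c) = (\<lambda>z. 0)" for A :: "complex^'n^'n" and c :: complex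
    by (simp add: fun_eq_iff lie_deriv_def frechet_derivative_const)
  then show ?thesis by (simp add: laplace_def)
qed

lemma laplace_sum:
  assumes "\<And>i. i \<in> I \<Longrightarrow> smooth_on \<Omega> (F i)" "z \<in> \<Omega>"
  shows "laplace B (\<lambda>z. \<Sum>i\<in>I. F i z) z = (\<Sum>i\<in>I. laplace B (F i) z)"
  using assms(1)
  by (induction I rule: infinite_finite_induct)
    (simp_all add: laplace_const laplace_add smooth_on_sum[OF open_dom] assms(2))

lemma laplace_mult:
  assumes F: "smooth_on \<Omega> F" and G: "smooth_on \<Omega> G" and z: "z \<in> \<Omega>"
  shows "laplace B (\<lambda>z. F z * G z) z =
    F z * laplace B G z + 2 * gradient_form B F G z + G z * laplace B F z"
proof -
  note sm = smooth_on_mult[OF open_dom]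
  have "lie_deriv A (lie_deriv A (\<lambda>z. F z * G z)) z =
      F z * lie_deriv A (lie_deriv A G) z + 2 * (lie_deriv A F z * lie_deriv A G z) +
      G z * lie_deriv A (lie_deriv A F) z" for A
  proof -
    have "lie_deriv A (lie_deriv A (\<lambda>z. F z * G z)) z =
        lie_deriv A (\<lambda>z. F z * lie_deriv A G z + lie_deriv A F z * G z) z"
      by (rule lie_deriv_cong[OF open_dom z]) (rule lie_deriv_mult[OF F G])
    also have "\<dots> = lie_deriv A (\<lambda>z. F z * lie_deriv A G z) z + lie_deriv A (\<lambda>z. lie_deriv A F z * G z) z"
      by (rule lie_deriv_add[OF sm[OF F smooth_lie_deriv[OF G]] sm[OF smooth_lie_deriv[OF F] G] z])
    finally show ?thesis
      unfolding lie_deriv_mult[OF F smooth_lie_deriv[OF G] z]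
        lie_deriv_mult[OF smooth_lie_deriv[OF F] G z] by (simp add: algebra_simps)
  qed
  then show ?thesis
    by (simp add: laplace_def gradient_form_def sum.distrib sum_distrib_left)
qed

text \<open>The product of \<open>F\<close> and its inverse is constant. Its Laplacian, expanded by
  the product rule, is solved for the Laplacian of the inverse.\<close>

lemma laplace_inverse:
  assumes F: "smooth_on \<Omega> F" and nz: "\<And>z. z \<in> \<Omega> \<Longrightarrow> F z \<noteq> 0" and z: "z \<in> \<Omega>"
  shows "laplace B (\<lambda>z. inverse (F z)) z =
    - (laplace B F z * inverse (F z) ^ 2) + 2 * gradient_form B F F z * inverse (F z) ^ 3"
proof -
  have inv: "smooth_on \<Omega> (\<lambda>z. inverse (F z))"
    using smooth_on_inverse[OF open_dom F nz] .
  have "laplace B (\<lambda>z. F z * inverse (F z)) z = laplace B (\<lambda>z. 1) z"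
    unfolding laplace_def
  proof (intro sum.cong refl lie_deriv_cong[OF open_dom z])
    fix y A assume "y \<in> \<Omega>"
    then show "lie_deriv A (\<lambda>z. F z * inverse (F z)) y = lie_deriv A (\<lambda>z. 1) y"
      using nz by (intro lie_deriv_cong[OF open_dom]) auto
  qed
  then have "F z * laplace B (\<lambda>z. inverse (F z)) z - 2 * (gradient_form B F F z * inverse (F z) ^ 2) +
      inverse (F z) * laplace B F z = 0"
    by (simp add: laplace_mult[OF F inv z] laplace_const[OF z]
        gradient_form_inverse_right[OF F z nz[OF z]])
  moreover have "F z * inverse (F z) = 1"
    using nz[OF z] by simp
  ultimately show ?thesis
    by algebra
qed

lemma gradient_form_power_right:
  assumes F: "smooth_on \<Omega> F" and z: "z \<in> \<Omega>"
  shows "gradient_form B H (\<lambda>z. F z ^ m) z = of_nat m * F z ^ (m - 1) * gradient_form B H F z"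
proof (induction m)
  case 0
  have "lie_deriv A (\<lambda>z. 1 :: complex) z = 0" for A
    by (simp add: lie_deriv_def frechet_derivative_const)
  then show ?case
    by (simp add: gradient_form_def)
next
  case (Suc m)
  have "gradient_form B H (\<lambda>z. F z * F z ^ m) z =
      F z * gradient_form B H (\<lambda>z. F z ^ m) z + F z ^ m * gradient_form B H F z"
    by (rule gradient_form_mult_right[OF F smooth_on_power[OF open_dom F] z])
  then have "gradient_form B H (\<lambda>z. F z ^ Suc m) z =
      F z * (of_nat m * F z ^ (m - 1) * gradient_form B H F z) + F z ^ m * gradient_form B H F z"
    by (simp only: power_Suc Suc.IH)
  also have "\<dots> = of_nat (Suc m) * F z ^ (Suc m - 1) * gradient_form B H F z"
    by (cases m) (simp_all add: algebra_simps)
  finally show ?case .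
qed

text \<open>Truncated subtraction is harmless here: wherever \<open>m - 1\<close> or
  \<open>m - 2\<close> is cut off, its coefficient is zero.\<close>

lemma laplace_power:
  assumes F: "smooth_on \<Omega> F" and z: "z \<in> \<Omega>"
  shows "laplace B (\<lambda>z. F z ^ m) z = of_nat m * F z ^ (m - 1) * laplace B F z +
    of_nat m * of_nat (m - 1) * F z ^ (m - 2) * gradient_form B F F z"
proof (induction m)
  case 0
  then show ?case
    by (simp add: laplace_const[OF z])
next
  case (Suc m)
  have "laplace B (\<lambda>z. F z * F z ^ m) z = F z * laplace B (\<lambda>z. F z ^ m) z +
      2 * gradient_form B F (\<lambda>z. F z ^ m) z + F z ^ m * laplace B F z"
    by (rule laplace_mult[OF F smooth_on_power[OF open_dom F] z])
  then have "laplace B (\<lambda>z. F z ^ Suc m) z =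
      F z * (of_nat m * F z ^ (m - 1) * laplace B F z +
        of_nat m * of_nat (m - 1) * F z ^ (m - 2) * gradient_form B F F z) +
      2 * (of_nat m * F z ^ (m - 1) * gradient_form B F F z) + F z ^ m * laplace B F z"
    by (simp only: power_Suc Suc.IH gradient_form_power_right[OF F z])
  also have "\<dots> = of_nat (Suc m) * F z ^ (Suc m - 1) * laplace B F z +
      of_nat (Suc m) * of_nat (Suc m - 1) * F z ^ (Suc m - 2) * gradient_form B F F z"
  proof -
    consider "m = 0" | "m = 1" | j where "m = Suc (Suc j)"
      by (metis One_nat_def not0_implies_Suc)
    then show ?thesis
      by cases (simp_all add: algebra_simps)
  qed
  finally show ?case .
qed

end

section \<open>Quotients of matrix coefficients\<close>

text \<open>With \<open>R\<close> and \<open>S\<close> obtained from \<open>P\<close> and \<open>Q\<close> by exchanging the column vectors \<open>a\<close> and \<open>b\<close>,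
  the contribution of \<open>c\<close> to the Laplacian cancels because \<open>P/Q\<close> is homogeneous of degree \<open>0\<close>,
  and \<open>\<tau>(P/Q) = -2 (P/Q - RS/Q\<^sup>2)\<close>.\<close>

locale fraction = lie_calculus \<Omega> B for \<Omega> B :: "(complex^'n^'n) set" +
  fixes c :: complex and a b p q :: "complex^'n"
  assumes casimir: "casimir c B"
    and Q_nonzero: "\<And>z. z \<in> \<Omega> \<Longrightarrow> matform q b z \<noteq> 0"
begin

definition f :: "complex^'n^'n \<Rightarrow> complex" where
  "f z = matform p a z * inverse (matform q b z)"

text \<open>Second building block of \<open>t\<close>. Both \<open>f\<close> and \<open>h\<close>
  have Laplacian \<open>t\<close>, which makes \<open>t\<close> harmonic, and every gradient form of
  the two is \<open>f\<close> or \<open>h\<close> times \<open>t\<close>.\<close>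

definition h :: "complex^'n^'n \<Rightarrow> complex" where
  "h z = matform p b z * matform q a z * (inverse (matform q b z) * inverse (matform q b z))"

definition t :: "complex^'n^'n \<Rightarrow> complex" where
  "t z = -2 * f z + 2 * h z"

lemma smooth_matform: "smooth_on \<Omega> (matform x y)"
  by (rule smooth_on_bounded_linear[OF open_dom bounded_linear_matform])

lemma smooth_inverse_Q: "smooth_on \<Omega> (\<lambda>z. inverse (matform q b z))"
  by (rule smooth_on_inverse[OF open_dom smooth_matform Q_nonzero])

lemma smooth_f: "smooth_on \<Omega> f"
  unfolding f_def[abs_def] by (rule smooth_on_mult[OF open_dom smooth_matform smooth_inverse_Q])

lemma smooth_RS: "smooth_on \<Omega> (\<lambda>z. matform p b z * matform q a z)"
  by (rule smooth_on_mult[OF open_dom smooth_matform smooth_matform])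

lemma smooth_inverse_Q2: "smooth_on \<Omega> (\<lambda>z. inverse (matform q b z) * inverse (matform q b z))"
  by (rule smooth_on_mult[OF open_dom smooth_inverse_Q smooth_inverse_Q])

lemma smooth_h: "smooth_on \<Omega> h"
  unfolding h_def[abs_def] by (rule smooth_on_mult[OF open_dom smooth_RS smooth_inverse_Q2])

lemma smooth_t: "smooth_on \<Omega> t"
  unfolding t_def[abs_def]
  by (intro smooth_on_add[OF open_dom] smooth_on_cmult[OF open_dom] smooth_f smooth_h)

text \<open>The Leibniz rules turn both sides into polynomials in P, Q, R, S, the inverse V of Q,
  and the constants \<open>c\<close> and n. What remains is polynomial algebra modulo QV =
  1.\<close>

lemma identities:
  assumes z: "z \<in> \<Omega>"
  shows laplace_f: "laplace B f z = t z"
    and laplace_h: "laplace B h z = t z"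
    and gradient_ff: "gradient_form B f f z = f z * t z"
    and gradient_fh: "gradient_form B f h z = h z * t z"
    and gradient_hh: "gradient_form B h h z = h z * t z"
proof -
  let ?n = "of_nat CARD('n) :: complex"
  define P Q R S where "P = matform p a z" and "Q = matform q b z" and "R = matform p b z"
    and "S = matform q a z"
  define V where "V = inverse Q"
  note defs = P_def[symmetric] Q_def[symmetric] R_def[symmetric] S_def[symmetric] V_def[symmetric]
  let ?V = "\<lambda>z. inverse (matform q b z)"
  have QV: "Q * V = 1"
    using Q_nonzero[OF z] by (simp add: V_def Q_def)
  note gm = gradient_form_matform[OF casimir] and lm = laplace_matform[OF casimir]
  have g_V: "gradient_form B F ?V z = - (gradient_form B F (matform q b) z * V ^ 2)" for F
    unfolding V_def Q_def by (rule gradient_form_inverse_right[OF smooth_matform z Q_nonzero[OF z]])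
  have g_mV: "gradient_form B (matform x y) ?V z =
      - ((c * matform x y z * Q - matform x b z * matform q y z) * V ^ 2)" for x y
    by (simp only: g_V gm defs)
  have g_Vm: "gradient_form B ?V (matform x y) z =
      - ((c * matform x y z * Q - matform x b z * matform q y z) * V ^ 2)" for x y
    by (subst gradient_form_commute) (rule g_mV)
  have g_VV: "gradient_form B ?V ?V z = (c * Q * Q - Q * Q) * V ^ 4"
    unfolding g_V g_Vm by (simp add: defs power2_eq_square power4_eq_xxxx mult_ac)
  have l_V: "laplace B ?V z = - ((c - ?n) * Q * V ^ 2) + 2 * (c * Q * Q - Q * Q) * V ^ 3"
    using laplace_inverse[of "matform q b" z, OF smooth_matform _ z] Q_nonzero by (simp only: gm lm defs not_False_eq_True)
  have fz: "f z = P * V" and hz: "h z = R * S * (V * V)" and tz: "t z = -2 * (P * V) + 2 * (R * S * (V * V))"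
    by (simp_all only: t_def f_def h_def defs)
  have f': "f = (\<lambda>z. matform p a z * inverse (matform q b z))"
    and h': "h = (\<lambda>z. matform p b z * matform q a z * (inverse (matform q b z) * inverse (matform q b z)))"
    by (simp_all add: fun_eq_iff f_def h_def)
  note gf = gradient_form_mult_right[OF smooth_matform smooth_inverse_Q z]
  note gRS = gradient_form_mult_right[OF smooth_matform smooth_matform z]
  note gVV = gradient_form_mult_right[OF smooth_inverse_Q smooth_inverse_Q z]
  note gh = gradient_form_mult_right[OF smooth_RS smooth_inverse_Q2 z]
  have g_f: "gradient_form B F f z = P * gradient_form B F ?V z + V * gradient_form B F (matform p a) z" for F
    unfolding f' gf defs ..
  have g_h: "gradient_form B F h z = R * S * (2 * V * gradient_form B F ?V z) +
      V * V * (R * gradient_form B F (matform q a) z + S * gradient_form B F (matform p b) z)" for F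
    unfolding h' gh gRS gVV defs by (simp add: algebra_simps)
  have f_g: "gradient_form B f F z = P * gradient_form B ?V F z + V * gradient_form B (matform p a) F z" for F
    using g_f[of F] by (simp only: gradient_form_commute[of B F])
  have h_g: "gradient_form B h F z = R * S * (2 * V * gradient_form B ?V F z) +
      V * V * (R * gradient_form B (matform q a) F z + S * gradient_form B (matform p b) F z)" for F
    using g_h[of F] by (simp only: gradient_form_commute[of B F])
  note expand = f_g h_g g_f g_h g_mV g_Vm g_VV gm defs fz hz tz
  show "gradient_form B f f z = f z * t z"
    unfolding expand using QV by algebra
  show "gradient_form B f h z = h z * t z"
    unfolding expand using QV by algebra
  show "gradient_form B h h z = h z * t z"
    unfolding expand using QV by algebra
  show "laplace B f z = t z"
    unfolding f' laplace_mult[OF smooth_matform smooth_inverse_Q z] l_V lm expand using QV by algebra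
  have RS_g: "gradient_form B (\<lambda>z. matform p b z * matform q a z) F z =
      R * gradient_form B (matform q a) F z + S * gradient_form B (matform p b) F z" for F
    using gRS[of F p b q a] by (simp only: defs gradient_form_commute[of B F])
  show "laplace B h z = t z"
    unfolding h' laplace_mult[OF smooth_RS smooth_inverse_Q2 z]
      laplace_mult[OF smooth_matform smooth_matform z]
      laplace_mult[OF smooth_inverse_Q smooth_inverse_Q z] gVV l_V lm
    unfolding RS_g expand using QV by algebra
qed

end

section \<open>Biharmonic homogeneous polynomials\<close>

text \<open>The Laplacian on coefficients with respect to e_0, ..., e_d: each entry receives a
  multiple of its predecessor and a diagonal multiple of itself. Entry 0 is zero because e_0 has no
  predecessor and its diagonal factor is 0.\<close>

definition shift_coeffs :: "nat \<Rightarrow> (nat \<Rightarrow> complex) \<Rightarrow> nat \<Rightarrow> complex" where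
  "shift_coeffs d c k = (case k of 0 \<Rightarrow> 0 | Suc j \<Rightarrow>
     (of_nat d ^ 2 - of_nat j ^ 2) * c j - 2 * of_nat (Suc j) * of_nat j * c (Suc j))"

context fraction
begin

lemma t_eq: "t = (\<lambda>z. -2 * f z + 2 * h z)"
  by (simp add: fun_eq_iff t_def)

lemma gradient_t_right:
  "z \<in> \<Omega> \<Longrightarrow> gradient_form B F t z = -2 * gradient_form B F f z + 2 * gradient_form B F h z"
  unfolding t_eq
  by (simp only: gradient_form_add_right[OF smooth_on_cmult[OF open_dom smooth_f]
        smooth_on_cmult[OF open_dom smooth_h]] gradient_form_cmult_right[OF smooth_f]
        gradient_form_cmult_right[OF smooth_h])

lemma gradient_t_left:
  "z \<in> \<Omega> \<Longrightarrow> gradient_form B t F z = -2 * gradient_form B f F z + 2 * gradient_form B h F z"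
  using gradient_t_right[of z F] by (simp only: gradient_form_commute[of B F])

lemma laplace_t: "z \<in> \<Omega> \<Longrightarrow> laplace B t z = 0"
  unfolding t_eq
  by (simp only: laplace_add[OF smooth_on_cmult[OF open_dom smooth_f] smooth_on_cmult[OF open_dom smooth_h]]
      laplace_cmult[OF smooth_f] laplace_cmult[OF smooth_h] laplace_f laplace_h) simp

lemma gradient_ft: "z \<in> \<Omega> \<Longrightarrow> gradient_form B f t z = t z ^ 2"
  by (simp add: gradient_t_right gradient_ff gradient_fh)
    (simp add: t_def power2_eq_square algebra_simps)

lemma gradient_tt: "z \<in> \<Omega> \<Longrightarrow> gradient_form B t t z = -2 * t z ^ 2"
  by (simp add: gradient_t_right gradient_t_left gradient_ff gradient_fh gradient_hh
      gradient_form_commute[of B h f])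
    (simp add: t_def power2_eq_square algebra_simps)

text \<open>The factor m(m + 2k) collects m^2 from the Laplacian of the power of \<open>f\<close>
  and 2mk from the mixed gradient form; for m + k = d it is d^2 - k^2. The second term stems from
  the gradient form of \<open>t\<close> with itself, as \<open>t\<close> is harmonic.\<close>

lemma laplace_monomial:
  assumes z: "z \<in> \<Omega>"
  shows "laplace B (\<lambda>z. f z ^ m * t z ^ k) z =
    of_nat m * (of_nat m + 2 * of_nat k) * f z ^ (m - 1) * t z ^ Suc k
    - 2 * of_nat k * (of_nat k - 1) * f z ^ m * t z ^ k"
proof -
  note fm = smooth_on_power[OF open_dom smooth_f] and tk = smooth_on_power[OF open_dom smooth_t]
  have f_m: "of_nat m * f z ^ (m - 1) * t z + of_nat m * of_nat (m - 1) * f z ^ (m - 2) * (f z * t z) =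
      of_nat m ^ 2 * f z ^ (m - 1) * t z"
  proof -
    consider "m = 0" | "m = 1" | j where "m = Suc (Suc j)"
      by (metis One_nat_def not0_implies_Suc)
    then show ?thesis
      by cases (simp_all add: algebra_simps power2_eq_square)
  qed
  have t_k: "of_nat k * of_nat (k - 1) * t z ^ (k - 2) * (-2 * t z ^ 2) =
      - 2 * of_nat k * (of_nat k - 1) * t z ^ k"
  proof -
    consider "k = 0" | "k = 1" | j where "k = Suc (Suc j)"
      by (metis One_nat_def not0_implies_Suc)
    then show ?thesis
      by cases (simp_all add: algebra_simps power2_eq_square)
  qed
  have g: "gradient_form B (\<lambda>z. f z ^ m) (\<lambda>z. t z ^ k) z =
      of_nat m * of_nat k * f z ^ (m - 1) * t z ^ Suc k"
  proof -
    have *: "gradient_form B (\<lambda>z. f z ^ m) t z = of_nat m * f z ^ (m - 1) * t z ^ 2"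
      by (subst gradient_form_commute)
        (simp add: gradient_form_power_right[OF smooth_f z] gradient_form_commute[of B t f] gradient_ft[OF z])
    show ?thesis
      unfolding gradient_form_power_right[OF smooth_t z] *
      by (cases k) (simp_all add: power2_eq_square)
  qed
  have "laplace B (\<lambda>z. f z ^ m * t z ^ k) z =
      f z ^ m * (- 2 * of_nat k * (of_nat k - 1) * t z ^ k) +
      2 * (of_nat m * of_nat k * f z ^ (m - 1) * t z ^ Suc k) +
      t z ^ k * (of_nat m ^ 2 * f z ^ (m - 1) * t z)"
    unfolding laplace_mult[OF fm tk z] g laplace_power[OF smooth_f z] laplace_power[OF smooth_t z]
      laplace_f[OF z] laplace_t[OF z] gradient_ff[OF z] gradient_tt[OF z] f_m t_k by simp
  then show ?thesis
    by (simp add: algebra_simps power2_eq_square)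
qed

definition homogeneous :: "nat \<Rightarrow> (nat \<Rightarrow> complex) \<Rightarrow> complex^'n^'n \<Rightarrow> complex" where
  "homogeneous d u z = (\<Sum>k = 0..d. u k * f z ^ (d - k) * t z ^ k)"

lemma smooth_homogeneous: "smooth_on \<Omega> (homogeneous d u)"
  unfolding homogeneous_def[abs_def] mult.assoc
  by (intro smooth_on_sum[OF open_dom] smooth_on_cmult[OF open_dom] smooth_on_mult[OF open_dom]
      smooth_on_power[OF open_dom] smooth_f smooth_t)

lemma laplace_homogeneous:
  assumes z: "z \<in> \<Omega>"
  shows "laplace B (homogeneous d u) z = homogeneous d (shift_coeffs d u) z"
proof -
  define E where "E k = f z ^ (d - k) * t z ^ k" for k
  note sm = smooth_on_mult[OF open_dom smooth_on_power[OF open_dom smooth_f]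
      smooth_on_power[OF open_dom smooth_t]]
  have "laplace B (homogeneous d u) z =
      (\<Sum>k = 0..d. u k * laplace B (\<lambda>z. f z ^ (d - k) * t z ^ k) z)"
    unfolding homogeneous_def[abs_def] mult.assoc
    by (simp only: laplace_sum[OF smooth_on_cmult[OF open_dom sm] z] laplace_cmult[OF sm z])
  also have "\<dots> = (\<Sum>k = 0..d. (of_nat d ^ 2 - of_nat k ^ 2) * u k * E (Suc k)
      - 2 * of_nat k * (of_nat k - 1) * u k * E k)"
  proof (intro sum.cong refl)
    fix k assume "k \<in> {0..d}"
    then have *: "(of_nat (d - k) :: complex) * (of_nat (d - k) + 2 * of_nat k) = of_nat d ^ 2 - of_nat k ^ 2"
      by (simp add: of_nat_diff power2_eq_square algebra_simps)
    show "u k * laplace B (\<lambda>z. f z ^ (d - k) * t z ^ k) z =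
        (of_nat d ^ 2 - of_nat k ^ 2) * u k * E (Suc k) - 2 * of_nat k * (of_nat k - 1) * u k * E k"
      unfolding laplace_monomial[OF z] E_def * by (simp add: algebra_simps)
  qed
  also have "\<dots> = (\<Sum>k<d. (of_nat d ^ 2 - of_nat k ^ 2) * u k * E (Suc k))
      - (\<Sum>k<d. 2 * of_nat (Suc k) * of_nat k * u (Suc k) * E (Suc k))"
  proof -
    \<comment> \<open>The term k = d has the factor 0, so the Laplacian does not leave the span of
      e_0, ..., e_d.\<close>
    have "(\<Sum>k = 0..d. (of_nat d ^ 2 - of_nat k ^ 2) * u k * E (Suc k)) =
        (\<Sum>k<d. (of_nat d ^ 2 - of_nat k ^ 2) * u k * E (Suc k))"
      by (rule sum.mono_neutral_right) (auto simp: not_less le_antisym)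
    moreover have "(\<Sum>k = 0..d. 2 * of_nat k * (of_nat k - 1) * u k * E k) =
        (\<Sum>k<d. 2 * of_nat (Suc k) * of_nat k * u (Suc k) * E (Suc k))"
      by (simp only: atLeast0AtMost sum.atMost_shift) simp
    ultimately show ?thesis
      by (simp only: sum_subtractf)
  qed
  also have "\<dots> = (\<Sum>k = 0..d. shift_coeffs d u k * E k)"
    by (simp only: atLeast0AtMost sum.atMost_shift) (simp add: shift_coeffs_def left_diff_distrib sum_subtractf)
  finally show ?thesis
    by (simp add: homogeneous_def E_def mult.assoc)
qed

end

text \<open>Solves \<open>shift_coeffs d u = 0\<close>. Entry 1 of this equation reads d^2 u_0 = 0
  and leaves u_1 free; the value d^2 is what the Laplacian of e_0 produces.\<close>

primrec harmonic_coeffs :: "nat \<Rightarrow> nat \<Rightarrow> complex" where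
  "harmonic_coeffs d 0 = 0"
| "harmonic_coeffs d (Suc k) = (if k = 0 then of_nat d ^ 2
     else (of_nat d ^ 2 - of_nat k ^ 2) / (2 * of_nat (Suc k) * of_nat k) * harmonic_coeffs d k)"

text \<open>Preimage of \<open>harmonic_coeffs\<close> under \<open>shift_coeffs d\<close>. The
  diagonal factor of e_1 is 0, so its coefficient can be chosen, here as 0, and the leading 1 alone
  accounts for d^2.\<close>

primrec biharmonic_coeffs :: "nat \<Rightarrow> nat \<Rightarrow> complex" where
  "biharmonic_coeffs d 0 = 1"
| "biharmonic_coeffs d (Suc k) = (if k = 0 then 0
     else ((of_nat d ^ 2 - of_nat k ^ 2) * biharmonic_coeffs d k - harmonic_coeffs d (Suc k))
       / (2 * of_nat (Suc k) * of_nat k))"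

lemma shift_harmonic_coeffs: "shift_coeffs d (harmonic_coeffs d) = (\<lambda>k. 0)"
  by (auto simp: fun_eq_iff shift_coeffs_def simp del: of_nat_Suc split: nat.split)

lemma shift_biharmonic_coeffs: "shift_coeffs d (biharmonic_coeffs d) = harmonic_coeffs d"
proof
  fix k
  show "shift_coeffs d (biharmonic_coeffs d) k = harmonic_coeffs d k"
  proof (cases k)
    case (Suc j)
    then show ?thesis
      by (cases j) (simp_all add: shift_coeffs_def del: of_nat_Suc harmonic_coeffs.simps(2),
          simp add: harmonic_coeffs.simps(2))
  qed (simp add: shift_coeffs_def)
qed

section \<open>Non-vanishing\<close>

text \<open>The ambient function \<open>F\<close> may vary transversally to the group, so the
  conclusion concerns only derivatives along left-invariant fields of SU(n).\<close>

lemma vanishing_derivative: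
  assumes "open \<Omega>" "\<And>y. y \<in> special_unitary_group \<inter> \<Omega> \<Longrightarrow> F y = 0"
    and "z \<in> special_unitary_group \<inter> \<Omega>" "A \<in> traceless_skew_hermitian"
    and "(F has_derivative F') (at z)"
  shows "F' (z ** A) = 0"
proof -
  let ?W = "special_unitary_group \<inter> \<Omega>"
  have v: "z ** A \<in> tangent_space ?W z"
    using assms(3,4) by (simp add: tangent_space_Int_open[OF assms(1)] tangent_space_special_unitary)
  show ?thesis
    using frechet_derivative_within_tangent[OF assms(3) v assms(5) assms(2)[symmetric]]
      frechet_derivative_within_tangent[OF assms(3) v has_derivative_const refl]
    by metis
qed

lemma casimir_special_unitary_basis:
  obtains B :: "(complex^'n^'n) set" where
    "span B = traceless_skew_hermitian"
    "\<And>A C. A \<in> B \<Longrightarrow> C \<in> B \<Longrightarrow> A \<bullet> C = (if A = C then 1 else 0)"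
    "casimir (1 / of_nat CARD('n)) B"
proof -
  obtain B :: "(complex^'n^'n) set" where B: "span B = traceless_skew_hermitian"
    "\<And>A C. A \<in> B \<Longrightarrow> C \<in> B \<Longrightarrow> A \<bullet> C = (if A = C then 1 else 0)"
    using orthonormal_basis_exists[OF subspace_traceless_skew_hermitian] by metis
  show thesis
    using B casimir_special_unitary[OF B(2,1)] by (rule that)
qed

section \<open>Density of the domain of P/Q in SU(n)\<close>

lemma matform_mat: "matform x y (mat s ** z) = s * matform x y z"
  by (simp add: matform_def mat_mult_component sum_distrib_left mult_ac)

lemma matform_nonzero_left:
  fixes x :: "complex^'n"
  assumes "z \<in> unitary_group" "x \<noteq> 0"
  obtains y where "matform x y z \<noteq> 0"
proof -
  have *: "matform x (axis k 1) z = (x v* z) $ k" for k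
    by (simp add: matform_def vector_matrix_mult_def axis_def if_distrib[of "\<lambda>t. t * _"]
        if_distrib[of "\<lambda>t. _ * t"] mult.commute cong: if_cong)
  have "x v* z \<noteq> 0"
  proof
    assume "x v* z = 0"
    then have "(x v* z) v* conj_transpose z = 0"
      by simp
    then show False
      using assms by (simp add: vector_matrix_mul_assoc unitaryD(1))
  qed
  then obtain k where "(x v* z) $ k \<noteq> 0"
    by (auto simp: vec_eq_iff)
  with * that show thesis by metis
qed

lemma matform_nonzero_right:
  fixes y :: "complex^'n"
  assumes "z \<in> unitary_group" "y \<noteq> 0"
  obtains x where "matform x y z \<noteq> 0"
proof -
  have *: "matform (axis k 1) y z = (z *v y) $ k" for k
  proof -
    have "matform (axis k 1) y z = (\<Sum>i\<in>UNIV. if i = k then (z *v y) $ i else 0)"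
      unfolding matform_def
      by (intro sum.cong refl) (auto simp: matrix_vector_mult_def axis_def mult.commute)
    then show ?thesis by simp
  qed
  have "z *v y \<noteq> 0"
  proof
    assume "z *v y = 0"
    then have "conj_transpose z *v (z *v y) = 0"
      by simp
    then show False
      using assms by (simp add: matrix_vector_mul_assoc unitaryD(2))
  qed
  then obtain k where "(z *v y) $ k \<noteq> 0"
    by (auto simp: vec_eq_iff)
  with * that show thesis by metis
qed

lemma special_unitary_subset: "special_unitary_group \<subseteq> unitary_group"
  by (auto simp: special_unitary_group_def)

text \<open>If Q vanished on SU(n) near \<open>z\<close>, so would its Lie derivatives. The Casimir
  sum of Q with an arbitrary form then gives \<open>matform q y z * matform x b z = 0\<close> for
  all \<open>x\<close> and \<open>y\<close>, which is impossible since \<open>z\<close> is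
  invertible and \<open>q\<close>, \<open>b\<close> are nonzero.\<close>

lemma matform_nonzero_dense:
  fixes q b :: "complex^'n"
  assumes "q \<noteq> 0" "b \<noteq> 0"
  shows "special_unitary_group \<subseteq> closure (special_unitary_group \<inter> {z. matform q b z \<noteq> 0})"
proof
  fix z :: "complex^'n^'n"
  assume z: "z \<in> special_unitary_group"
  show "z \<in> closure (special_unitary_group \<inter> {z. matform q b z \<noteq> 0})"
  proof (rule ccontr)
    let ?\<Omega> = "- closure (special_unitary_group \<inter> {z. matform q b z \<noteq> 0})"
    assume "z \<notin> closure (special_unitary_group \<inter> {z. matform q b z \<noteq> 0})"
    then have z': "z \<in> special_unitary_group \<inter> ?\<Omega>"
      using z by simp
    have zero: "matform q b y = 0" if "y \<in> special_unitary_group \<inter> ?\<Omega>" for y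
    proof (rule ccontr)
      assume "matform q b y \<noteq> 0"
      with that have "y \<in> special_unitary_group \<inter> {z. matform q b z \<noteq> 0}"
        by simp
      from subsetD[OF closure_subset this] that show False
        by simp
    qed
    obtain B :: "(complex^'n^'n) set" where B: "span B = traceless_skew_hermitian"
        "casimir (1 / of_nat CARD('n)) B"
      using casimir_special_unitary_basis by metis
    have "matform q b (z ** A) = 0" if "A \<in> B" for A
      using vanishing_derivative[of ?\<Omega>, OF _ zero z' _ matform_has_derivative] that B(1) span_base
      by auto
    then have "(\<Sum>A\<in>B. matform q b (z ** A) * matform x y (z ** A)) = 0" for x y
      by simp
    then have "matform q y z * matform x b z = 0" for x y
      using casimir_sum_matform[OF B(2), of q b z x y] zero[OF z'] by simp
    then show False
      using matform_nonzero_left[of z q] matform_nonzero_right[of z b] assms z special_unitary_subset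
      by (metis mult_eq_0_iff subsetD)
  qed
qed

section \<open>Polynomial relations for the ratio of \<open>f\<close> and \<open>t\<close>\<close>

lemma has_derivative_poly:
  fixes r :: "'a::real_normed_vector \<Rightarrow> 'b::real_normed_field"
  assumes "(r has_derivative r') (at z)"
  shows "((\<lambda>z. poly s (r z)) has_derivative (\<lambda>v. poly (pderiv s) (r z) * r' v)) (at z)"
  using has_derivative_compose[OF assms poly_DERIV[unfolded has_field_derivative_def]] by simp

context fraction
begin

text \<open>If \<open>t\<close> does not vanish, then \<open>f/t\<close> is nowhere locally constant on the group, since
  \<open>f = r t\<close> with constant \<open>r\<close> would give \<open>t = \<tau>(f) = r \<tau>(t) = 0\<close>.\<close>

lemma poly_ratio_pderiv:
  assumes span: "span B = traceless_skew_hermitian"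
    and s: "\<And>z. z \<in> special_unitary_group \<inter> (\<Omega> \<inter> {z. t z \<noteq> 0}) \<Longrightarrow> poly s (f z / t z) = 0"
    and z: "z \<in> special_unitary_group \<inter> (\<Omega> \<inter> {z. t z \<noteq> 0})"
  shows "poly (pderiv s) (f z / t z) = 0"
proof (rule ccontr)
  assume nz: "poly (pderiv s) (f z / t z) \<noteq> 0"
  define \<Omega>' where "\<Omega>' = \<Omega> \<inter> {z. t z \<noteq> 0}"
  define r where "r z = f z / t z" for z
  \<comment> \<open>Here s'(r) is nonzero, so differentiating s(r) = 0 along the group makes the Lie
    derivatives of \<open>r\<close> vanish. The set is open, which allows a second
    differentiation.\<close>
  define \<Omega>'' where "\<Omega>'' = \<Omega>' \<inter> {z. poly (pderiv s) (r z) \<noteq> 0}"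
  have open': "open \<Omega>'"
    unfolding \<Omega>'_def
    using continuous_open_preimage[OF smooth_on_continuous[OF smooth_t] open_dom, of "- {0}"]
    by (simp add: vimage_def open_Compl)
  have sm: "smooth_on \<Omega>' f" "smooth_on \<Omega>' t"
    by (rule smooth_on_subset[OF smooth_f] smooth_on_subset[OF smooth_t]; simp add: \<Omega>'_def)+
  have r: "smooth_on \<Omega>' r"
    unfolding r_def[abs_def] by (rule smooth_on_divide[OF open' sm]) (simp add: \<Omega>'_def)
  have "continuous_on \<Omega>' (\<lambda>z. poly (pderiv s) (r z))"
    by (intro continuous_intros smooth_on_continuous[OF r])
  from continuous_open_preimage[OF this open', of "- {0}"] have open'': "open \<Omega>''"
    by (simp add: \<Omega>''_def vimage_def open_Compl)
  have sub: "\<Omega>'' \<subseteq> \<Omega>'"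
    by (simp add: \<Omega>''_def)
  have z'': "z \<in> special_unitary_group \<inter> \<Omega>''"
    using z nz by (simp add: \<Omega>''_def \<Omega>'_def r_def)
  have lie_r: "lie_deriv A r y = 0"
    if y: "y \<in> special_unitary_group \<inter> \<Omega>''" and A: "A \<in> B" for y A
  proof -
    have "y \<in> \<Omega>'" "A \<in> traceless_skew_hermitian"
      using y sub A span span_base by auto
    then have "poly (pderiv s) (r y) * frechet_derivative r (at y) (y ** A) = 0"
      using y s by (intro vanishing_derivative[OF open' _ _ _
            has_derivative_poly[OF smooth_on_has_derivative[OF r]], of s])
        (auto simp: r_def \<Omega>'_def)
    then show ?thesis
      using y by (simp add: \<Omega>''_def lie_deriv_def)
  qed
  have lie_lie_r: "lie_deriv A (lie_deriv A r) z = 0" if A: "A \<in> B" for A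
    unfolding lie_deriv_def[of A "lie_deriv A r"]
    using vanishing_derivative[OF open'' lie_r[OF _ A] z'' _
        smooth_on_has_derivative[OF smooth_on_lie_deriv[OF open' r]]] A span span_base z'' sub by blast
  interpret L: lie_calculus \<Omega>' B
    by unfold_locales (rule open')
  have z': "z \<in> \<Omega>'" "z \<in> \<Omega>"
    using z by (auto simp: \<Omega>'_def)
  have "t z = laplace B f z"
    using laplace_f[OF z'(2)] by simp
  also have "\<dots> = laplace B (\<lambda>y. r y * t y) z"
    unfolding laplace_def
  proof (intro sum.cong refl lie_deriv_cong[OF open' z'(1)])
    fix y A assume "y \<in> \<Omega>'"
    then show "lie_deriv A f y = lie_deriv A (\<lambda>y. r y * t y) y"
      by (intro lie_deriv_cong[OF open']) (auto simp: r_def \<Omega>'_def)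
  qed
  also have "\<dots> = r z * laplace B t z + 2 * gradient_form B r t z + t z * laplace B r z"
    by (rule L.laplace_mult[OF r sm(2) z'(1)])
  also have "\<dots> = 0"
    using laplace_t[OF z'(2)] lie_r[OF z''] lie_lie_r by (simp add: gradient_form_def laplace_def)
  finally show False
    using z by simp
qed

text \<open>By induction on the degree the derivative of \<open>s\<close> is the zero polynomial, so
  \<open>s\<close> is constant in characteristic zero. Evaluation at a point where \<open>t\<close>
  is nonzero shows that the constant is 0.\<close>

lemma poly_ratio_nonzero:
  assumes span: "span B = traceless_skew_hermitian"
    and ne: "special_unitary_group \<inter> (\<Omega> \<inter> {z. t z \<noteq> 0}) \<noteq> {}"
    and s: "\<And>z. z \<in> special_unitary_group \<inter> (\<Omega> \<inter> {z. t z \<noteq> 0}) \<Longrightarrow> poly s (f z / t z) = 0"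
  shows "s = 0"
  using s
proof (induction "degree s" arbitrary: s rule: less_induct)
  case less
  from ne obtain z where z: "z \<in> special_unitary_group \<inter> (\<Omega> \<inter> {z. t z \<noteq> 0})"
    by blast
  have "degree s = 0"
  proof (rule ccontr)
    assume "degree s \<noteq> 0"
    then have "pderiv s = 0"
      using less.hyps[of "pderiv s"] poly_ratio_pderiv[OF span less.prems] by (simp add: degree_pderiv)
    with \<open>degree s \<noteq> 0\<close> show False
      by (simp add: pderiv_eq_0_iff)
  qed
  then obtain a where "s = [:a:]"
    by (rule degree_eq_zeroE)
  with less.prems[OF z] show ?case
    by simp
qed

text \<open>Dividing by the d-th power of \<open>t\<close> turns identical vanishing into a
  polynomial equation for f/t. Its coefficient in degree d - 1 comes from k = 1 alone and is d^2,
  which is nonzero.\<close>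

lemma homogeneous_harmonic_nonzero:
  assumes span: "span B = traceless_skew_hermitian"
    and ne: "special_unitary_group \<inter> (\<Omega> \<inter> {z. t z \<noteq> 0}) \<noteq> {}"
    and d: "d > 0"
  shows "\<exists>z\<in>special_unitary_group \<inter> \<Omega>. homogeneous d (harmonic_coeffs d) z \<noteq> 0"
proof (rule ccontr)
  assume neg: "\<not> ?thesis"
  define s where "s = (\<Sum>k = 0..d. monom (harmonic_coeffs d k) (d - k))"
  have "s = 0"
  proof (rule poly_ratio_nonzero[OF span ne])
    fix z assume z: "z \<in> special_unitary_group \<inter> (\<Omega> \<inter> {z. t z \<noteq> 0})"
    have "homogeneous d (harmonic_coeffs d) z = t z ^ d * poly s (f z / t z)"
      unfolding homogeneous_def s_def poly_sum poly_monom sum_distrib_left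
    proof (intro sum.cong refl)
      fix k assume "k \<in> {0..d}"
      then have "t z ^ d = t z ^ k * t z ^ (d - k)"
        by (simp flip: power_add)
      then show "harmonic_coeffs d k * f z ^ (d - k) * t z ^ k =
          t z ^ d * (harmonic_coeffs d k * (f z / t z) ^ (d - k))"
        using z by (simp add: power_divide)
    qed
    then show "poly s (f z / t z) = 0"
      using neg z by auto
  qed
  have "coeff s (d - 1) = (\<Sum>k = 0..d. if k = 1 then harmonic_coeffs d k else 0)"
    unfolding s_def coeff_sum using d by (intro sum.cong refl) auto
  also have "\<dots> = of_nat d ^ 2"
    using d by simp
  finally show False
    using \<open>s = 0\<close> d by simp
qed

end

section \<open>Assembly on the part of SU(n) where Q is nonzero\<close>

theorem theorem5p5:
  fixes a b p q :: "complex^'n"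
    and P Q f :: "complex^'n^'n \<Rightarrow> complex"
    and W :: "(complex^'n^'n) set"
    and d :: nat
  assumes nonzero: "a \<noteq> 0" "b \<noteq> 0" "p \<noteq> 0" "q \<noteq> 0"
    and P: "P = (\<lambda>z. \<Sum>j\<in>UNIV. \<Sum>\<alpha>\<in>UNIV. p $ j * a $ \<alpha> * z $ j $ \<alpha>)"
    and Q: "Q = (\<lambda>z. \<Sum>k\<in>UNIV. \<Sum>\<beta>\<in>UNIV. q $ k * b $ \<beta> * z $ k $ \<beta>)"
    and not_identically_zero:
      "\<exists>z\<in>unitary_group. P z * Q z + kappa GL_metric unitary_group P Q z \<noteq> 0"
    and W: "W = {z \<in> special_unitary_group. Q z \<noteq> 0}"
    and f: "f = (\<lambda>z. P z / Q z)"
    and d: "d > 0"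
  shows "openin (top_of_set special_unitary_group) W \<and>
    special_unitary_group \<subseteq> closure W \<and>
    (\<exists>c :: nat \<Rightarrow> complex.
       proper_biharmonic_on GL_metric W
         (\<lambda>z. \<Sum>k = 0..d. c k * f z ^ (d - k) * tau GL_metric W f z ^ k))"
proof -
  define \<Omega> where "\<Omega> = {z. matform q b z \<noteq> 0}"
  have P': "P = matform p a" and Q': "Q = matform q b"
    by (simp_all add: P Q matform_def fun_eq_iff)
  have W': "W = special_unitary_group \<inter> \<Omega>"
    by (auto simp: W Q' \<Omega>_def)
  have cont: "continuous_on UNIV (matform x y)" for x y :: "complex^'n"
    by (rule linear_continuous_on[OF bounded_linear_matform])
  have "open \<Omega>"
    using open_Collect_neq[OF cont continuous_on_const, of q b 0] by (simp add: \<Omega>_def)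
  obtain B :: "(complex^'n^'n) set" where B: "span B = traceless_skew_hermitian"
      "\<And>A C. A \<in> B \<Longrightarrow> C \<in> B \<Longrightarrow> A \<bullet> C = (if A = C then 1 else 0)"
      "casimir (1 / of_nat CARD('n)) B"
    using casimir_special_unitary_basis by metis
  interpret F: fraction \<Omega> B "1 / of_nat CARD('n)" a b p q
    by unfold_locales (use \<open>open \<Omega>\<close> B(3) in \<open>auto simp: \<Omega>_def\<close>)
  interpret W: left_translated W traceless_skew_hermitian B
    unfolding W' using \<open>open \<Omega>\<close> B(1,2) by (rule left_translated_special_unitary)
  have sub: "W \<subseteq> \<Omega>"
    by (simp add: W')
  have f': "f = F.f"
    by (simp add: f P' Q' F.f_def fun_eq_iff divide_inverse)
  have tau_laplace: "tau GL_metric W G z = laplace B G' z"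
    if "z \<in> W" "smooth_on \<Omega> G'" "\<And>y. y \<in> W \<Longrightarrow> G y = G' y" for G G' z
    unfolding laplace_def by (rule W.tau_eq[OF that(1) \<open>open \<Omega>\<close> sub that(2,3)])
  have tau_f: "tau GL_metric W f z = F.t z" if "z \<in> W" for z
    using tau_laplace[OF that F.smooth_f, of f] F.laplace_f that sub by (auto simp: f')
  have dense: "special_unitary_group \<subseteq> closure W"
    unfolding W' \<Omega>_def by (rule matform_nonzero_dense[OF nonzero(4,2)])

  \<comment> \<open>Up to the factor -2/Q^2 this is \<open>F.t\<close>. As a polynomial it also
    makes sense where Q vanishes, possibly at the point of U(n) that the hypothesis
    supplies.\<close>
  define D where "D z = matform p a z * matform q b z - matform p b z * matform q a z" for z
  have "special_unitary_group \<inter> (\<Omega> \<inter> {z. F.t z \<noteq> 0}) \<noteq> {}"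
  proof -
    obtain z where z: "z \<in> unitary_group" "P z * Q z + kappa GL_metric unitary_group P Q z \<noteq> 0"
      using not_identically_zero by blast
    obtain C :: "(complex^'n^'n) set" where C: "span C = skew_hermitian"
        "\<And>A A'. A \<in> C \<Longrightarrow> A' \<in> C \<Longrightarrow> A \<bullet> A' = (if A = A' then 1 else 0)"
      using orthonormal_basis_exists[OF subspace_skew_hermitian] by metis
    \<comment> \<open>On U(n) the Casimir constant is 0, so only the product with exchanged column
      vectors remains.\<close>
    have "kappa GL_metric unitary_group P Q z = - (matform p b z * matform q a z)"
      using left_translated.kappa_eq[OF left_translated_unitary[OF C] z(1) matform_has_derivative
          matform_has_derivative, of P p a Q q b]
        casimir_sum_matform[OF casimir_unitary[OF C(2,1)]] by (simp add: P' Q')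
    with z(2) have "D z \<noteq> 0"
      by (simp add: D_def P' Q')
    moreover obtain s where s: "s \<noteq> 0" "mat s ** z \<in> special_unitary_group"
      using unitary_phase[OF z(1)] by metis
    moreover have "D (mat s ** z) = s ^ 2 * D z"
      by (simp add: D_def matform_mat power2_eq_square algebra_simps)
    \<comment> \<open>Q may vanish at the rescaled point, but by density the open set where
      \<open>D\<close> is nonzero still meets \<open>W\<close>.\<close>
    ultimately have "mat s ** z \<in> {y. D y \<noteq> 0} \<inter> closure W"
      using dense by auto
    moreover have "open {y. D y \<noteq> 0}"
      unfolding D_def by (intro open_Collect_neq continuous_intros cont)
    ultimately obtain y where y: "y \<in> W" "D y \<noteq> 0"
      using open_Int_closure_eq_empty[of "{y. D y \<noteq> 0}" W] by blast
    then have "matform q b y \<noteq> 0"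
      by (simp add: W' \<Omega>_def)
    then have "F.t y = -2 * D y / matform q b y ^ 2"
      by (simp add: F.t_def F.f_def F.h_def D_def field_simps power2_eq_square)
    with y \<open>matform q b y \<noteq> 0\<close> show ?thesis
      by (auto simp: W')
  qed
  from F.homogeneous_harmonic_nonzero[OF B(1) this d]
  obtain z\<^sub>0 where z\<^sub>0: "z\<^sub>0 \<in> W" "F.homogeneous d (harmonic_coeffs d) z\<^sub>0 \<noteq> 0"
    by (auto simp: W')

  define \<Phi> where "\<Phi> z = (\<Sum>k = 0..d. biharmonic_coeffs d k * f z ^ (d - k) * tau GL_metric W f z ^ k)" for z
  have \<Phi>: "\<Phi> z = F.homogeneous d (biharmonic_coeffs d) z" if "z \<in> W" for z
    unfolding \<Phi>_def tau_f[OF that] F.homogeneous_def unfolding f' ..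
  have tau_\<Phi>: "tau GL_metric W \<Phi> z = F.homogeneous d (harmonic_coeffs d) z" if "z \<in> W" for z
    using tau_laplace[OF that F.smooth_homogeneous \<Phi>] F.laplace_homogeneous[of z] that sub
    by (auto simp: shift_biharmonic_coeffs)
  have "tau GL_metric W (tau GL_metric W \<Phi>) z = F.homogeneous d (\<lambda>k. 0) z" if "z \<in> W" for z
    using tau_laplace[OF that F.smooth_homogeneous tau_\<Phi>] F.laplace_homogeneous[of z] that sub
    by (auto simp: shift_harmonic_coeffs)
  then have "tau GL_metric W (tau GL_metric W \<Phi>) z = 0" if "z \<in> W" for z
    using that by (simp add: F.homogeneous_def)
  moreover have "smooth_on_submanifold W \<Phi>"
    unfolding smooth_on_submanifold_def
  proof
    fix z assume "z \<in> W"
    then have "open \<Omega> \<and> z \<in> \<Omega> \<and> (\<forall>k. Ck_on k \<Omega> (F.homogeneous d (biharmonic_coeffs d))) \<and>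
        (\<forall>x\<in>\<Omega> \<inter> W. F.homogeneous d (biharmonic_coeffs d) x = \<Phi> x)"
      using \<open>open \<Omega>\<close> sub F.smooth_homogeneous \<Phi> by (auto simp: smooth_on_def)
    then show "\<exists>U h. open U \<and> z \<in> U \<and> (\<forall>k. Ck_on k U h) \<and> (\<forall>x\<in>U \<inter> W. h x = \<Phi> x)"
      by blast
  qed
  ultimately have "proper_biharmonic_on GL_metric W \<Phi>"
    using z\<^sub>0 tau_\<Phi> unfolding proper_biharmonic_on_def by metis
  moreover have "openin (top_of_set special_unitary_group) W"
    unfolding W' using \<open>open \<Omega>\<close> by (rule openin_open_Int)
  ultimately show ?thesis
    using dense unfolding \<Phi>_def[abs_def] by blast
qed

end
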